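(* Let $K$ be a field of characteristic $\neq2$ and let $A_\tau$ be the free braided associative algebra on $x_1,x_2$ with an involutive diagonal braiding $\tau=(q_{11},q_{12},q_{21},q_{22})$. Then: (1) $\mathrm{Aut}\,A_\tau=\mathrm{Aut}\,K\langle x_1,x_2\rangle$ if $q_{ij}=1$ for all $i,j$; (2) $\mathrm{Aut}\,A_\tau=G_{\mathrm{odd}}$ if $q_{ij}=-1$ for all $i,j$; (3) $\mathrm{Aut}\,A_\tau\cong(K^*\times K^* )\rtimes\mathbb{Z}_2$ if $q_{11}=q_{22}$, $q_{12}=q_{21}$ and $q_{11}q_{12}=-1$; (4) $\mathrm{Aut}\,A_\tau\cong G_4$ if $q_{12}=1$ and $q_{11}q_{22}=-1$; (5) $\mathrm{Aut}\,A_\tau\cong K^*\times K^*$ if $q_{12}\neq\pm1$, or if $q_{12}=-1$ and $q_{11}q_{22}=-1$.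
   Context: $A=K\langle x_1,x_2\rangle$ is the free associative algebra with unit on $x_1,x_2$; $\varphi=(f_1,f_2)$ denotes the algebra endomorphism with $\varphi(x_1)=f_1$, $\varphi(x_2)=f_2$. For $q_{ij}\in K$, the diagonal braiding $\tau=(q_{11},q_{12},q_{21},q_{22})$ on $A$ is the linear map $A\otimes A\to A\otimes A$ given on words $u,v$ by $(u\otimes v)\tau=q_{11}^{s_1t_1}q_{12}^{s_1t_2}q_{21}^{s_2t_1}q_{22}^{s_2t_2}\,(v\otimes u)$, where $s_i$ (resp. $t_i$) is the number of occurrences of $x_i$ in $u$ (resp. $v$); it is the unique braided-algebra extension of $x_i\otimes x_j\mapsto q_{ij}x_j\otimes x_i$. It is involutive iff $q_{11}^2=q_{22}^2=q_{12}q_{21}=1$. $A_\tau$ is $A$ equipped with $\tau$, and $\mathrm{Aut}\,A_\tau$ is the group of algebra automorphisms $\varphi$ of $A$ satisfying $(\varphi\otimes\varphi)((w)\tau)=((\varphi\otimes\varphi)(w))\tau$ for all $w\in A\otimes A$, viewed as a subgroup of $\mathrm{Aut}\,K\langle x_1,x_2\rangle$. $G_{\mathrm{odd}}$ is the group of automorphisms $(f_1,f_2)$ of $A$ with $f_1,f_2$ both in the linear span of words of odd length. $G_4=\{(\alpha_1x_1+g(x_2^2),\beta_2x_2)\mid\alpha_1,\beta_2\in K^*,\ g(x)\in K[x]\}\subseteq\mathrm{Aut}\,K\langle x_1,x_2\rangle$. In (3), $\mathbb{Z}_2$ acts on $K^*\times K^*$ by swapping the factors. *)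

theory Defs
  imports "HOL-Algebra.Group" "HOL-Computational_Algebra.Polynomial"
begin

datatype var = X1 | X2

text \<open>Elements of K<x1,x2> are finitely supported functions from words to K
  (coefficient of each word).\<close>
type_synonym 'k ncp = "var list \<Rightarrow> 'k"

definition ncA :: "('k::field) ncp set" where
  "ncA = {p. finite {w. p w \<noteq> 0}}"

definition nc_one :: "('k::field) ncp" where
  "nc_one = (\<lambda>w. if w = [] then 1 else 0)"

definition nc_var :: "var \<Rightarrow> ('k::field) ncp" where
  "nc_var a = (\<lambda>w. if w = [a] then 1 else 0)"

definition nc_mult :: "('k::field) ncp \<Rightarrow> 'k ncp \<Rightarrow> 'k ncp" where
  "nc_mult f g = (\<lambda>w. \<Sum>i\<le>length w. f (take i w) * g (drop i w))"

definition nc_pow :: "('k::field) ncp \<Rightarrow> nat \<Rightarrow> 'k ncp" where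
  "nc_pow f n = (nc_mult f ^^ n) nc_one"

definition nc_poly_eval :: "('k::field) poly \<Rightarrow> 'k ncp \<Rightarrow> 'k ncp" where
  "nc_poly_eval g a = (\<lambda>w. \<Sum>k\<le>degree g. coeff g k * nc_pow a k w)"

definition nc_sub :: "'k ncp \<Rightarrow> 'k ncp \<Rightarrow> var \<Rightarrow> 'k ncp" where
  "nc_sub f1 f2 a = (if a = X1 then f1 else f2)"

definition eval_word :: "('k::field) ncp \<Rightarrow> 'k ncp \<Rightarrow> var list \<Rightarrow> 'k ncp" where
  "eval_word f1 f2 w = foldr (\<lambda>a acc. nc_mult (nc_sub f1 f2 a) acc) w nc_one"

definition nc_hom :: "('k::field) ncp \<Rightarrow> 'k ncp \<Rightarrow> 'k ncp \<Rightarrow> 'k ncp" where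
  "nc_hom f1 f2 p = (\<lambda>z. \<Sum>w\<in>{w. p w \<noteq> 0}. p w * eval_word f1 f2 w z)"

definition AutFree :: "(('k::field) ncp \<times> 'k ncp) set" where
  "AutFree = {(f1, f2). f1 \<in> ncA \<and> f2 \<in> ncA \<and> bij_betw (nc_hom f1 f2) ncA ncA}"

definition aut_comp :: "('k::field) ncp \<times> 'k ncp \<Rightarrow> 'k ncp \<times> 'k ncp \<Rightarrow> 'k ncp \<times> 'k ncp" where
  "aut_comp \<phi> \<psi> = (nc_hom (fst \<phi>) (snd \<phi>) (fst \<psi>), nc_hom (fst \<phi>) (snd \<phi>) (snd \<psi>))"

definition aut_group :: "(('k::field) ncp \<times> 'k ncp) set \<Rightarrow> ('k ncp \<times> 'k ncp) monoid" where
  "aut_group S = \<lparr>carrier = S, Group.monoid.mult = aut_comp, Group.monoid.one = (nc_var X1, nc_var X2)\<rparr>"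

type_synonym 'k nct = "var list \<times> var list \<Rightarrow> 'k"

definition ncT :: "('k::field) nct set" where
  "ncT = {t. finite {uv. t uv \<noteq> 0}}"

definition tens_hom :: "('k::field) ncp \<Rightarrow> 'k ncp \<Rightarrow> 'k nct \<Rightarrow> 'k nct" where
  "tens_hom f1 f2 t = (\<lambda>(z1, z2). \<Sum>uv\<in>{uv. t uv \<noteq> 0}.
      t uv * eval_word f1 f2 (fst uv) z1 * eval_word f1 f2 (snd uv) z2)"

definition braid_chi :: "(var \<Rightarrow> var \<Rightarrow> 'k::field) \<Rightarrow> var list \<Rightarrow> var list \<Rightarrow> 'k" where
  "braid_chi q u v =
     q X1 X1 ^ (count_list u X1 * count_list v X1) *
     q X1 X2 ^ (count_list u X1 * count_list v X2) *
     q X2 X1 ^ (count_list u X2 * count_list v X1) *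
     q X2 X2 ^ (count_list u X2 * count_list v X2)"

text \<open>(u \<otimes> v)tau = chi(u,v) (v \<otimes> u), extended linearly.\<close>
definition braid :: "(var \<Rightarrow> var \<Rightarrow> 'k::field) \<Rightarrow> 'k nct \<Rightarrow> 'k nct" where
  "braid q t = (\<lambda>(a, b). braid_chi q b a * t (b, a))"

definition involutive_braiding :: "(var \<Rightarrow> var \<Rightarrow> 'k::field) \<Rightarrow> bool" where
  "involutive_braiding q \<longleftrightarrow> q X1 X1 ^ 2 = 1 \<and> q X2 X2 ^ 2 = 1 \<and> q X1 X2 * q X2 X1 = 1"

definition AutBr :: "(var \<Rightarrow> var \<Rightarrow> 'k::field) \<Rightarrow> ('k ncp \<times> 'k ncp) set" where
  "AutBr q = {\<phi> \<in> AutFree. \<forall>t\<in>ncT.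
      tens_hom (fst \<phi>) (snd \<phi>) (braid q t) = braid q (tens_hom (fst \<phi>) (snd \<phi>) t)}"

definition odd_part :: "('k::field) ncp \<Rightarrow> bool" where
  "odd_part f \<longleftrightarrow> (\<forall>w. f w \<noteq> 0 \<longrightarrow> odd (length w))"

definition Godd :: "(('k::field) ncp \<times> 'k ncp) set" where
  "Godd = {(f1, f2) \<in> AutFree. odd_part f1 \<and> odd_part f2}"

definition G4 :: "(('k::field) ncp \<times> 'k ncp) set" where
  "G4 = {(\<lambda>w. \<alpha> * nc_var X1 w + nc_poly_eval g (nc_pow (nc_var X2) 2) w,
          \<lambda>w. \<beta> * nc_var X2 w) | \<alpha> \<beta> g. \<alpha> \<noteq> 0 \<and> \<beta> \<noteq> 0}"

definition units2 :: "('k::field \<times> 'k) monoid" where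
  "units2 = \<lparr>carrier = {(a, b). a \<noteq> 0 \<and> b \<noteq> 0},
             Group.monoid.mult = (\<lambda>(a, b) (c, d). (a * c, b * d)), Group.monoid.one = (1, 1)\<rparr>"

text \<open>(K* x K*) \<rtimes> Z2, Z2 = bool acting by swapping the factors.\<close>
definition units2_swap :: "(('k::field \<times> 'k) \<times> bool) monoid" where
  "units2_swap = \<lparr>carrier = {((a, b), s). a \<noteq> 0 \<and> b \<noteq> 0},
     Group.monoid.mult = (\<lambda>((a, b), s) ((c, d), t).
               (if s then (a * d, b * c) else (a * c, b * d), s \<noteq> t)),
     Group.monoid.one = ((1, 1), False)\<rparr>"

end

theory Submission
  imports Defs
begin

text \<open>Fix a total order on words that is compatible with concatenation, and let \<open>u1, u2\<close> be the leading
  words of \<open>f1, f2\<close>. If \<open>u1, u2\<close> do not commute they generate a free monoid, so no leading terms cancel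
  in a polynomial in \<open>f1, f2\<close>; since \<open>x1, x2\<close> are such polynomials, \<open>{u1, u2} = {x1, x2}\<close>.
  If they commute they are powers of one word.

  An automorphism respects the braiding iff the bicharacter \<open>\<chi>\<close> equals \<open>q i j\<close> on the supports of
  \<open>f_i\<close> and \<open>f_j\<close>. As \<open>\<chi>(z, z) = \<plusminus>1\<close>, commuting leading words contradict this in cases (3) and (5), and the
  degree order then shows that \<open>f1, f2\<close> are multiples of variables. In case (4) one varies the
  weights that define the order.\<close>

section \<open>The free algebra and its endomorphisms\<close>

text \<open>The orders need not be well-founded and may place \<open>[]\<close> above other words: a
  leading word exists because supports are finite, and the absence of cancellation rests only on
  totality and compatibility with concatenation. This freedom is what permits negative weights for
  x2. The obstacle is case (4). The automorphism x1 -> x1 + x2^2, x2 -> x2 has the commuting leading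
  words x2^2 and x2 in the degree order, so that order gives no bound on the supports, and the
  braiding contributes only a parity condition on the number of letters x2. A weight that makes x2
  very negative brings x1 and x2 back to the top. A term x2^(2k) of f1 overtakes x1 only at the
  positive weight 1/(2k), whereas the unwanted terms would have to overtake at a weight that is at
  most 0. Case (4) claims only an isomorphism because it also covers the braiding in which x1 and x2
  have exchanged roles.\<close>

lemma nc_mult_Nil [simp]: "nc_mult f g [] = f [] * g []"
  by (simp add: nc_mult_def)

text \<open>A product rule for the left derivative \<open>\<lambda>v. f (a # v)\<close>. It allows
  identities between products to be proved by induction on the word of evaluation with
  \<open>f\<close> arbitrary, so associativity needs no reindexing of double sums.\<close>

lemma nc_mult_Cons: "nc_mult f g (a # w) = f [] * g (a # w) + nc_mult (\<lambda>v. f (a # v)) g w"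
  by (simp add: nc_mult_def sum.atMost_Suc_shift del: sum.atMost_Suc)

lemma nc_mult_linear_left:
  "nc_mult (\<lambda>v. c * f v + d * g v) h w = c * nc_mult f h w + d * nc_mult g h w"
  by (simp add: nc_mult_def sum.distrib sum_distrib_left algebra_simps)

lemma nc_mult_assoc: "nc_mult (nc_mult f g) h = nc_mult f (nc_mult g h)"
proof
  fix w show "nc_mult (nc_mult f g) h w = nc_mult f (nc_mult g h) w"
  proof (induction w arbitrary: f)
    case Nil
    show ?case by simp
  next
    case (Cons a w)
    have "nc_mult (\<lambda>v. nc_mult f g (a # v)) h w
        = f [] * nc_mult (\<lambda>v. g (a # v)) h w + nc_mult (nc_mult (\<lambda>v. f (a # v)) g) h w"
      using nc_mult_linear_left[of "f []" "\<lambda>v. g (a # v)" 1 "nc_mult (\<lambda>v. f (a # v)) g" h w]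
      by (simp add: nc_mult_Cons)
    then show ?case
      by (simp add: nc_mult_Cons Cons.IH algebra_simps)
  qed
qed

lemma nc_mult_one_left [simp]: "nc_mult nc_one f = f"
proof
  fix w
  have "(\<Sum>i\<le>length w. nc_one (take i w) * f (drop i w)) = (\<Sum>i\<in>{0}. nc_one (take i w) * f (drop i w))"
    by (rule sum.mono_neutral_right) (auto simp: nc_one_def)
  then show "nc_mult nc_one f w = f w"
    by (simp add: nc_mult_def nc_one_def)
qed

lemma nc_mult_one_right [simp]: "nc_mult f nc_one = f"
proof
  fix w
  have "(\<Sum>i\<le>length w. f (take i w) * nc_one (drop i w))
      = (\<Sum>i\<in>{length w}. f (take i w) * nc_one (drop i w))"
    by (rule sum.mono_neutral_right) (auto simp: nc_one_def)
  then show "nc_mult f nc_one w = f w"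
    by (simp add: nc_mult_def nc_one_def)
qed

lemma nc_mult_support:
  assumes "nc_mult f g w \<noteq> 0"
  obtains u v where "w = u @ v" "f u \<noteq> 0" "g v \<noteq> 0"
proof -
  obtain i where "f (take i w) * g (drop i w) \<noteq> 0"
    using assms unfolding nc_mult_def by (meson sum.neutral)
  then show thesis
    by (intro that[of "take i w" "drop i w"]) auto
qed

text \<open>Cut positions of \<open>w\<close> correspond to factorizations of \<open>w\<close>.
  Indexing by pairs from the supports is the form in which \<open>nc_hom_mult\<close> can exchange
  its sums.\<close>

lemma nc_mult_eq_sum:
  assumes "finite F" "finite G" "{u. f u \<noteq> 0} \<subseteq> F" "{v. g v \<noteq> 0} \<subseteq> G"
  shows "nc_mult f g w = (\<Sum>(u, v)\<in>F \<times> G. if u @ v = w then f u * g v else 0)"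
proof -
  let ?S = "(\<lambda>i. (take i w, drop i w)) ` {..length w}"
  have inj: "inj_on (\<lambda>i. (take i w, drop i w)) {..length w}"
    by (rule inj_onI) (metis Pair_inject atMost_iff length_take min.absorb2)
  have "(\<Sum>(u, v)\<in>F \<times> G. if u @ v = w then f u * g v else 0)
      = (\<Sum>(u, v)\<in>(F \<times> G) \<inter> ?S. f u * g v)"
  proof (rule sum.mono_neutral_cong_right)
    show "\<forall>i\<in>F \<times> G - (F \<times> G) \<inter> ?S.
        (case i of (u, v) \<Rightarrow> if u @ v = w then f u * g v else 0) = 0"
    proof clarify
      fix u v assume "(u, v) \<notin> (F \<times> G) \<inter> ?S" "u \<in> F" "v \<in> G"
      moreover have "u @ v = w \<Longrightarrow> (u, v) \<in> ?S"
        by (rule image_eqI[where x = "length u"]) auto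
      ultimately show "(if u @ v = w then f u * g v else 0) = 0" by auto
    qed
  qed (use assms in auto)
  also have "\<dots> = (\<Sum>(u, v)\<in>?S. f u * g v)"
    by (rule sum.mono_neutral_left) (use assms in auto)
  also have "\<dots> = nc_mult f g w"
    by (simp add: sum.reindex[OF inj] nc_mult_def)
  finally show ?thesis by simp
qed

lemma ncA_mult [intro]:
  assumes "f \<in> ncA" "g \<in> ncA"
  shows "nc_mult f g \<in> ncA"
proof -
  have "{w. nc_mult f g w \<noteq> 0} \<subseteq> (\<lambda>(u, v). u @ v) ` ({u. f u \<noteq> 0} \<times> {v. g v \<noteq> 0})"
    by (auto elim!: nc_mult_support)
  then show ?thesis
    using assms unfolding ncA_def by (auto intro: finite_subset)
qed

lemma ncA_one [simp]: "nc_one \<in> ncA"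
  by (simp add: ncA_def nc_one_def)

lemma ncA_var [simp]: "nc_var a \<in> ncA"
  by (simp add: ncA_def nc_var_def)

lemma ncA_zero [simp]: "(\<lambda>w. 0) \<in> ncA"
  by (simp add: ncA_def)

lemma ncA_scale [intro]: "f \<in> ncA \<Longrightarrow> (\<lambda>w. c * f w) \<in> ncA"
  unfolding ncA_def by (auto elim: rev_finite_subset)

lemma ncA_add [intro]: 
  assumes "f \<in> ncA" "g \<in> ncA" shows "(\<lambda>w. f w + g w) \<in> ncA"
proof -
  have "{w. f w + g w \<noteq> 0} \<subseteq> {w. f w \<noteq> 0} \<union> {w. g w \<noteq> 0}" by auto
  then show ?thesis
    using assms unfolding ncA_def by (auto intro: finite_subset)
qed

lemma ncA_sum: "finite S \<Longrightarrow> (\<And>s. s \<in> S \<Longrightarrow> f s \<in> ncA) \<Longrightarrow> (\<lambda>w. \<Sum>s\<in>S. f s w) \<in> ncA"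
  by (induction S rule: finite_induct) auto

lemma eval_word_Nil [simp]: "eval_word f1 f2 [] = nc_one"
  by (simp add: eval_word_def)

lemma eval_word_Cons [simp]:
  "eval_word f1 f2 (a # w) = nc_mult (nc_sub f1 f2 a) (eval_word f1 f2 w)"
  by (simp add: eval_word_def)

lemma eval_word_append:
  "eval_word f1 f2 (u @ v) = nc_mult (eval_word f1 f2 u) (eval_word f1 f2 v)"
  by (induction u) (simp_all add: nc_mult_assoc)

lemma eval_word_in_ncA [intro]:
  "f1 \<in> ncA \<Longrightarrow> f2 \<in> ncA \<Longrightarrow> eval_word f1 f2 w \<in> ncA"
  by (induction w) (auto simp: nc_sub_def)

lemma nc_hom_eq_sum:
  assumes "finite S" "{w. p w \<noteq> 0} \<subseteq> S"
  shows "nc_hom f1 f2 p z = (\<Sum>w\<in>S. p w * eval_word f1 f2 w z)"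
  unfolding nc_hom_def by (rule sum.mono_neutral_left) (use assms in auto)

lemma nc_hom_in_ncA [intro]:
  "f1 \<in> ncA \<Longrightarrow> f2 \<in> ncA \<Longrightarrow> p \<in> ncA \<Longrightarrow> nc_hom f1 f2 p \<in> ncA"
  unfolding nc_hom_def
  by (rule ncA_sum) (simp add: ncA_def, rule ncA_scale, rule eval_word_in_ncA)

lemma nc_hom_sum:
  assumes "finite S" "\<And>s. s \<in> S \<Longrightarrow> g s \<in> ncA"
  shows "nc_hom f1 f2 (\<lambda>w. \<Sum>s\<in>S. c s * g s w) z = (\<Sum>s\<in>S. c s * nc_hom f1 f2 (g s) z)"
proof -
  let ?T = "\<Union>s\<in>S. {w. g s w \<noteq> 0}"
  have fin: "finite ?T" using assms by (auto simp: ncA_def)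
  have "nc_hom f1 f2 (\<lambda>w. \<Sum>s\<in>S. c s * g s w) z
      = (\<Sum>w\<in>?T. (\<Sum>s\<in>S. c s * g s w) * eval_word f1 f2 w z)"
  proof (rule nc_hom_eq_sum[OF fin], rule subsetI)
    fix w assume "w \<in> {w. (\<Sum>s\<in>S. c s * g s w) \<noteq> 0}"
    then obtain s where "s \<in> S" "c s * g s w \<noteq> 0"
      by (metis (mono_tags, lifting) mem_Collect_eq sum.neutral)
    then show "w \<in> ?T" by auto
  qed
  also have "\<dots> = (\<Sum>s\<in>S. c s * (\<Sum>w\<in>?T. g s w * eval_word f1 f2 w z))"
    by (simp add: sum_distrib_left sum_distrib_right mult.assoc) (rule sum.swap)
  also have "\<dots> = (\<Sum>s\<in>S. c s * nc_hom f1 f2 (g s) z)"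
  proof (rule sum.cong[OF refl])
    fix s assume "s \<in> S"
    then show "c s * (\<Sum>w\<in>?T. g s w * eval_word f1 f2 w z) = c s * nc_hom f1 f2 (g s) z"
      by (subst nc_hom_eq_sum[OF fin]) auto
  qed
  finally show ?thesis .
qed

lemma nc_hom_add_scale:
  assumes "f \<in> ncA" "g \<in> ncA"
  shows "nc_hom f1 f2 (\<lambda>w. c * f w + d * g w) z = c * nc_hom f1 f2 f z + d * nc_hom f1 f2 g z"
  using nc_hom_sum[of "UNIV :: bool set" "\<lambda>b. if b then f else g" f1 f2 "\<lambda>b. if b then c else d" z] assms
  by (simp add: UNIV_bool add.commute)

lemma nc_hom_scale:
  assumes "f \<in> ncA"
  shows "nc_hom f1 f2 (\<lambda>w. c * f w) z = c * nc_hom f1 f2 f z"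
  using nc_hom_add_scale[OF assms assms, of f1 f2 c 0] by simp

lemma nc_hom_var [simp]: "nc_hom f1 f2 (nc_var a) = nc_sub f1 f2 a"
proof
  fix z
  show "nc_hom f1 f2 (nc_var a) z = nc_sub f1 f2 a z"
    by (subst nc_hom_eq_sum[where S = "{[a]}"]) (auto simp: nc_var_def)
qed

lemma nc_hom_one [simp]: "nc_hom f1 f2 nc_one = nc_one"
proof
  fix z
  show "nc_hom f1 f2 nc_one z = nc_one z"
    by (subst nc_hom_eq_sum[where S = "{[]}"]) (auto simp: nc_one_def)
qed

lemma nc_hom_mult:
  assumes "f \<in> ncA" "g \<in> ncA"
  shows "nc_hom f1 f2 (nc_mult f g) = nc_mult (nc_hom f1 f2 f) (nc_hom f1 f2 g)"
proof
  fix z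
  let ?F = "{u. f u \<noteq> 0}" and ?G = "{v. g v \<noteq> 0}" and ?E = "eval_word f1 f2"
  let ?W = "(\<lambda>(u, v). u @ v) ` (?F \<times> ?G)"
  have fin: "finite ?F" "finite ?G" using assms by (auto simp: ncA_def)
  have m: "nc_mult f g w = (\<Sum>x\<in>?F \<times> ?G. if fst x @ snd x = w then f (fst x) * g (snd x) else 0)" for w
    by (subst nc_mult_eq_sum[OF fin]) (auto simp: case_prod_beta)
  have "nc_hom f1 f2 (nc_mult f g) z = (\<Sum>w\<in>?W. nc_mult f g w * ?E w z)"
    by (rule nc_hom_eq_sum) (use fin in \<open>auto elim!: nc_mult_support\<close>)
  also have "\<dots> = (\<Sum>x\<in>?F \<times> ?G. \<Sum>w\<in>?W.
      (if fst x @ snd x = w then f (fst x) * g (snd x) * ?E w z else 0))"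
    unfolding m sum_distrib_right by (subst sum.swap) (simp add: if_distrib[of "\<lambda>c. c * _"] cong: if_cong)
  also have "\<dots> = (\<Sum>x\<in>?F \<times> ?G. f (fst x) * g (snd x) * ?E (fst x @ snd x) z)"
  proof (rule sum.cong[OF refl])
    fix x assume "x \<in> ?F \<times> ?G"
    then have "fst x @ snd x \<in> ?W" by (force simp: image_iff)
    moreover have "finite ?W" using fin by simp
    ultimately show "(\<Sum>w\<in>?W. if fst x @ snd x = w then f (fst x) * g (snd x) * ?E w z else 0)
        = f (fst x) * g (snd x) * ?E (fst x @ snd x) z"
      by (subst sum.delta') auto
  qed
  also have "\<dots> = (\<Sum>u\<in>?F. \<Sum>v\<in>?G. \<Sum>i\<le>length z. (f u * ?E u (take i z)) * (g v * ?E v (drop i z)))"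
    by (subst sum.cartesian_product)
       (simp add: eval_word_append nc_mult_def sum_distrib_left mult_ac case_prod_beta)
  also have "\<dots> = (\<Sum>i\<le>length z. \<Sum>u\<in>?F. \<Sum>v\<in>?G. (f u * ?E u (take i z)) * (g v * ?E v (drop i z)))"
    by (subst sum.swap[of _ "{..length z}"], subst sum.swap[of _ _ "{..length z}"], rule refl)
  also have "\<dots> = nc_mult (nc_hom f1 f2 f) (nc_hom f1 f2 g) z"
    unfolding nc_mult_def nc_hom_def sum_product ..
  finally show "nc_hom f1 f2 (nc_mult f g) z = nc_mult (nc_hom f1 f2 f) (nc_hom f1 f2 g) z" .
qed

lemma nc_hom_eval_word:
  assumes "g1 \<in> ncA" "g2 \<in> ncA"
  shows "nc_hom f1 f2 (eval_word g1 g2 w) = eval_word (nc_hom f1 f2 g1) (nc_hom f1 f2 g2) w"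
proof (induction w)
  case (Cons a w)
  have "nc_sub g1 g2 a \<in> ncA" using assms by (simp add: nc_sub_def)
  then show ?case
    using Cons.IH assms by (simp add: nc_hom_mult eval_word_in_ncA) (simp add: nc_sub_def)
qed simp

lemma nc_hom_comp:
  assumes "g1 \<in> ncA" "g2 \<in> ncA" "p \<in> ncA"
  shows "nc_hom f1 f2 (nc_hom g1 g2 p) = nc_hom (nc_hom f1 f2 g1) (nc_hom f1 f2 g2) p"
proof
  fix z
  have "finite {w. p w \<noteq> 0}" using assms by (simp add: ncA_def)
  then have "nc_hom f1 f2 (nc_hom g1 g2 p) z
      = (\<Sum>w\<in>{w. p w \<noteq> 0}. p w * nc_hom f1 f2 (eval_word g1 g2 w) z)"
    unfolding nc_hom_def[of g1 g2 p] by (rule nc_hom_sum) (use assms in auto)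
  then show "nc_hom f1 f2 (nc_hom g1 g2 p) z = nc_hom (nc_hom f1 f2 g1) (nc_hom f1 f2 g2) p z"
    by (simp add: nc_hom_eval_word assms) (simp add: nc_hom_def)
qed

text \<open>Besides giving \<open>nc_hom_id\<close>, this identifies the indicator function of a
  word with a monomial, so that products and powers of indicators follow from
  \<open>eval_word_append\<close>.\<close>

lemma eval_word_vars: "eval_word (nc_var X1) (nc_var X2) w = (\<lambda>z. if z = w then 1 else 0 :: 'a::field)"
proof (induction w)
  case Nil
  then show ?case by (simp add: nc_one_def fun_eq_iff)
next
  case IH: (Cons a w)
  have sub: "nc_sub (nc_var X1) (nc_var X2) a = (nc_var a :: 'a ncp)"
    by (cases a) (auto simp: nc_sub_def)
  show ?case
  proof
    fix z
    show "eval_word (nc_var X1) (nc_var X2) (a # w) z = (if z = a # w then 1 else 0 :: 'a)"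
    proof (cases z)
      case (Cons b y)
      have "(\<lambda>v. nc_var a (b # v)) = (\<lambda>v. (if a = b then 1 else 0 :: 'a) * nc_one v + 0 * nc_one v)"
        by (auto simp: nc_var_def nc_one_def)
      then have "nc_mult (\<lambda>v. nc_var a (b # v)) h y = (if a = b then h y else 0)" for h :: "'a ncp"
        by (simp only: nc_mult_linear_left nc_mult_one_left) simp
      moreover have "nc_var a [] = (0 :: 'a)" by (simp add: nc_var_def)
      ultimately show ?thesis
        using IH Cons by (auto simp: sub nc_mult_Cons)
    qed (simp add: sub, simp add: nc_var_def)
  qed
qed

lemma nc_hom_id [simp]:
  assumes "p \<in> ncA" shows "nc_hom (nc_var X1) (nc_var X2) p = p"
proof
  fix z
  have fin: "finite {w. p w \<noteq> 0}" using assms by (simp add: ncA_def)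
  show "nc_hom (nc_var X1) (nc_var X2) p z = p z"
    unfolding nc_hom_def eval_word_vars
    using sum.delta'[OF fin, of z p] by (cases "p z = 0") (simp_all add: if_distrib cong: if_cong)
qed

lemma AutFree_if_inverse:
  assumes "f1 \<in> ncA" "f2 \<in> ncA" "g1 \<in> ncA" "g2 \<in> ncA"
    and "aut_comp (f1, f2) (g1, g2) = (nc_var X1, nc_var X2)"
    and "aut_comp (g1, g2) (f1, f2) = (nc_var X1, nc_var X2)"
  shows "(f1, f2) \<in> AutFree"
proof -
  have "bij_betw (nc_hom f1 f2) ncA ncA"
    by (rule bij_betw_byWitness[where f' = "nc_hom g1 g2"])
       (use assms in \<open>auto simp: nc_hom_comp aut_comp_def\<close>)
  then show ?thesis using assms by (simp add: AutFree_def)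
qed

lemma AutFree_nonzero:
  assumes "(f1, f2) \<in> AutFree"
  shows "nc_sub f1 f2 a \<noteq> (\<lambda>w. 0)"
proof
  assume "nc_sub f1 f2 a = (\<lambda>w. 0)"
  then have "nc_hom f1 f2 (nc_var a) = nc_hom f1 f2 (\<lambda>w. 0)"
    by (simp add: nc_hom_def[of _ _ "\<lambda>w. 0"])
  then have "nc_var a = (\<lambda>w. 0 :: 'a)"
    using assms inj_onD[of "nc_hom f1 f2" ncA "nc_var a" "\<lambda>w. 0"]
    unfolding AutFree_def bij_betw_def by simp
  then show False by (metis nc_var_def one_neq_zero)
qed

section \<open>Leading words\<close>

text \<open>Computes the leading word of the product formed by \<open>eval_word\<close> when
  \<open>u\<close> and \<open>v\<close> lead its two factors.\<close>

fun subst_word :: "var list \<Rightarrow> var list \<Rightarrow> var list \<Rightarrow> var list" where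
  "subst_word u v [] = []"
| "subst_word u v (X1 # w) = u @ subst_word u v w"
| "subst_word u v (X2 # w) = v @ subst_word u v w"

lemma subst_word_append: "subst_word u v (w @ w') = subst_word u v w @ subst_word u v w'"
  by (induction u v w rule: subst_word.induct) auto

lemma subst_word_subst_word:
  "subst_word u v (subst_word p r w) = subst_word (subst_word u v p) (subst_word u v r) w"
  by (induction p r w rule: subst_word.induct) (auto simp: subst_word_append)

fun swap_var :: "var \<Rightarrow> var" where
  "swap_var X1 = X2"
| "swap_var X2 = X1"

lemma swap_var_swap_var [simp]: "swap_var (swap_var a) = a"
  by (cases a) auto

lemma swap_var_comp [simp]: "swap_var \<circ> swap_var = id"
  by (simp add: fun_eq_iff)

lemma subst_word_swap: "subst_word u v (map swap_var w) = subst_word v u w"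
  by (induction v u w rule: subst_word.induct) auto

text \<open>If \<open>v = u v'\<close> then words in \<open>u, v\<close> are words in the shorter pair \<open>u, v'\<close>, and a coincidence
  of two words with different first letters descends to such a coincidence.\<close>
lemma subst_word_inj:
  assumes "u @ v \<noteq> v @ u" "subst_word u v w = subst_word u v w'"
  shows "w = w'"
  using assms
proof (induction "length u + length v" arbitrary: u v w w' rule: less_induct)
  case less
  have ne: "u \<noteq> []" "v \<noteq> []" using less.prems(1) by auto
  have clash: False
    if len: "length p + length r = length u + length v" and pr: "p @ r \<noteq> r @ p"
      and short: "length p \<le> length r" and eq: "p @ subst_word p r x = r @ subst_word p r y"
    for p r x y
  proof -
    obtain r' where r': "r = p @ r'"
      using eq short by (metis append_eq_append_conv_if append_take_drop_id)
    have sub: "subst_word p r t = subst_word p r' (subst_word [X1] [X1, X2] t)" for t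
      by (simp add: subst_word_subst_word r')
    have ne: "p \<noteq> []" "r' \<noteq> []" using pr r' by auto
    have eq': "subst_word p r x = r' @ subst_word p r y"
      using eq r' by simp
    then have "x \<noteq> []" using ne by auto
    \<comment> \<open>Both \<open>[X1]\<close> and \<open>[X1, X2]\<close> begin with
      \<open>X1\<close>, so a nonempty word is rewritten to one beginning with \<open>X1\<close>,
      while \<open>r'\<close> puts an \<open>X2\<close> in front on the other side. The first
      letters differ again, now over the shorter pair \<open>p\<close>, \<open>r'\<close>.\<close>
    then obtain x' where x': "subst_word [X1] [X1, X2] x = X1 # x'"
      by (cases x; cases "hd x") auto
    have 1: "subst_word p r' (X1 # x') = subst_word p r' (X2 # subst_word [X1] [X1, X2] y)"
      using eq' x' sub[of x] sub[of y] by simp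
    have 2: "p @ r' \<noteq> r' @ p" using pr unfolding r' by (metis append.assoc)
    have 3: "length p + length r' < length u + length v"
      using len r' ne(1) by (cases p) auto
    show False using less.hyps[OF 3 2 1] by simp
  qed
  have first: False if "u @ subst_word u v x = v @ subst_word u v y" for x y
  proof (cases "length u \<le> length v")
    case True
    then show ?thesis using clash[of u v x y] that less.prems(1) by simp
  next
    case False
    then show ?thesis
      using clash[of v u "map swap_var y" "map swap_var x"] that less.prems(1)
      by (simp add: subst_word_swap add.commute)
  qed
  have nil: "subst_word u v t = [] \<longleftrightarrow> t = []" for t
    using ne by (cases t; cases "hd t") auto
  have "subst_word u v x = subst_word u v y \<Longrightarrow> x = y" for x y
  proof (induction x arbitrary: y)
    case Nil
    then show ?case using nil[of y] by simp
  next
    case (Cons a x)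
    then obtain b y' where y: "y = b # y'" using nil[of "a # x"] by (cases y) auto
    show ?case
    proof (cases "a = b")
      case True
      then have "subst_word u v x = subst_word u v y'" using Cons.prems y by (cases b) simp_all
      then show ?thesis using Cons.IH y True by simp
    next
      case False
      then have "u @ subst_word u v x = v @ subst_word u v y'
          \<or> u @ subst_word u v y' = v @ subst_word u v x"
        using Cons.prems y by (cases a; cases b) simp_all
      then show ?thesis using first by blast
    qed
  qed
  then show ?case using less.prems(2) .
qed

lemma commuting_words_powers:
  assumes "u @ v = v @ (u :: 'a list)"
  obtains z m n where "u = concat (replicate m z)" "v = concat (replicate n z)"
proof -
  have "\<exists>m n z. concat (replicate m z) = u \<and> concat (replicate n z) = v"
    using comm_append_are_replicate[OF assms] .
  then show thesis using that by blast
qed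

section \<open>Leading words for a total order compatible with concatenation\<close>

locale word_order =
  fixes lt :: "var list \<Rightarrow> var list \<Rightarrow> bool"  (infix \<open>\<prec>\<close> 50)
  assumes irrefl: "\<not> u \<prec> u"
    and trans: "u \<prec> v \<Longrightarrow> v \<prec> w \<Longrightarrow> u \<prec> w"
    and total: "u \<noteq> v \<Longrightarrow> u \<prec> v \<or> v \<prec> u"
    and append_left: "u \<prec> v \<Longrightarrow> w @ u \<prec> w @ v"
    and append_right: "u \<prec> v \<Longrightarrow> u @ w \<prec> v @ w"
begin

definition leading :: "('k::field) ncp \<Rightarrow> var list \<Rightarrow> bool" where
  "leading f u \<longleftrightarrow> f u \<noteq> 0 \<and> (\<forall>v. f v \<noteq> 0 \<longrightarrow> v = u \<or> v \<prec> u)"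

lemma finite_has_greatest:
  assumes "finite S" "S \<noteq> {}"
  shows "\<exists>u\<in>S. \<forall>v\<in>S. v = u \<or> v \<prec> u"
  using assms
proof (induction S rule: finite_ne_induct)
  case (insert x F)
  from insert.IH obtain u where u: "u \<in> F" and max: "\<And>v. v \<in> F \<Longrightarrow> v = u \<or> v \<prec> u"
    by (elim bexE) simp
  show ?case
  proof (cases "u \<prec> x")
    case True
    have "v \<prec> x" if "v \<in> F" for v
      using max[OF that] True trans[of v u x] by (elim disjE) simp_all
    then show ?thesis by simp
  next
    case False
    then have "x = u \<or> x \<prec> u" using total[of u x] by (cases "u = x") simp_all
    then have "\<forall>v\<in>insert x F. v = u \<or> v \<prec> u" using max by simp
    then show ?thesis using u by (intro bexI[of _ u]) simp_all
  qed
qed simp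

lemma leading_exists:
  assumes "f \<in> ncA" "f \<noteq> (\<lambda>w. 0)"
  obtains u where "leading f u"
  using finite_has_greatest[of "{w. f w \<noteq> 0}"] assms
  unfolding leading_def ncA_def by auto

lemma leading_unique: "leading f u \<Longrightarrow> leading f v \<Longrightarrow> u = v"
  unfolding leading_def using irrefl[of u] trans[of u v u] by blast

lemma append_less:
  assumes "u' = u \<or> u' \<prec> u" "v' = v \<or> v' \<prec> v" "u' \<noteq> u \<or> v' \<noteq> v"
  shows "u' @ v' \<prec> u @ v"
  using assms append_left[of v' v u] append_right[of u' u v'] trans[of "u' @ v'" "u @ v'" "u @ v"]
  by blast

text \<open>If a cut of \<open>u @ v\<close> at another position had two nonzero coefficients, its
  factors would be at most \<open>u\<close> and \<open>v\<close> and not both equal to them, and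
  \<open>append_less\<close> would put \<open>u @ v\<close> below itself. Hence a single product
  remains, nonzero because K is a field.\<close>

lemma leading_mult:
  assumes "leading f u" "leading g v"
  shows "leading (nc_mult f g) (u @ v)"
proof -
  have "(\<Sum>i\<le>length (u @ v). f (take i (u @ v)) * g (drop i (u @ v)))
      = (\<Sum>i\<in>{length u}. f (take i (u @ v)) * g (drop i (u @ v)))"
  proof (rule sum.mono_neutral_right)
    show "\<forall>i\<in>{..length (u @ v)} - {length u}. f (take i (u @ v)) * g (drop i (u @ v)) = 0"
    proof (rule ballI, rule ccontr)
      fix i assume i: "i \<in> {..length (u @ v)} - {length u}"
        and "f (take i (u @ v)) * g (drop i (u @ v)) \<noteq> 0"
      then have "take i (u @ v) = u \<or> take i (u @ v) \<prec> u" "drop i (u @ v) = v \<or> drop i (u @ v) \<prec> v"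
        using assms unfolding leading_def by auto
      moreover have "length (take i (u @ v)) \<noteq> length u" using i by auto
      then have "take i (u @ v) \<noteq> u" by metis
      ultimately have "take i (u @ v) @ drop i (u @ v) \<prec> u @ v"
        by (intro append_less) auto
      then show False using irrefl[of "u @ v"] by (simp only: append_take_drop_id)
    qed
  qed auto
  then have "nc_mult f g (u @ v) = f u * g v"
    by (simp add: nc_mult_def)
  moreover have "w = u @ v \<or> w \<prec> u @ v" if "nc_mult f g w \<noteq> 0" for w
    using that
  proof (rule nc_mult_support)
    fix u' v' assume "w = u' @ v'" "f u' \<noteq> 0" "g v' \<noteq> 0"
    then show ?thesis
      using assms append_less[of u' u v' v] unfolding leading_def by metis
  qed
  moreover have "f u * g v \<noteq> 0" using assms unfolding leading_def by simp
  ultimately show ?thesis unfolding leading_def by simp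
qed

lemma leading_eval_word:
  assumes "leading f1 u1" "leading f2 u2"
  shows "leading (eval_word f1 f2 w) (subst_word u1 u2 w)"
proof (induction w)
  case Nil
  show ?case by (simp add: leading_def nc_one_def)
next
  case (Cons a w)
  then show ?case
    using assms leading_mult by (cases a) (auto simp: nc_sub_def)
qed

text \<open>By \<open>subst_word_inj\<close>, distinct monomials have distinct leading words. The
  greatest of these comes from a single monomial of \<open>p\<close>, so its coefficient cannot
  cancel.\<close>

lemma leading_nc_hom:
  assumes lead: "leading f1 u1" "leading f2 u2" and nc: "u1 @ u2 \<noteq> u2 @ u1"
    and p: "p \<in> ncA" "p \<noteq> (\<lambda>w. 0)"
  obtains w where "leading (nc_hom f1 f2 p) (subst_word u1 u2 w)"
proof -
  let ?S = "{w. p w \<noteq> 0}" and ?U = "subst_word u1 u2"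
  have fin: "finite ?S" using p by (simp add: ncA_def)
  obtain w where w: "p w \<noteq> 0" and max: "\<And>v. p v \<noteq> 0 \<Longrightarrow> ?U v = ?U w \<or> ?U v \<prec> ?U w"
    using finite_has_greatest[of "?U ` ?S"] fin p by auto
  have max': "v = w \<or> ?U v \<prec> ?U w" if "p v \<noteq> 0" for v
    using max[OF that] subst_word_inj[OF nc] by blast
  have lead': "leading (eval_word f1 f2 v) (?U v)" for v
    using lead by (rule leading_eval_word)
  have "(\<Sum>v\<in>?S. p v * eval_word f1 f2 v (?U w)) = (\<Sum>v\<in>{w}. p v * eval_word f1 f2 v (?U w))"
  proof (rule sum.mono_neutral_right[OF fin])
    show "\<forall>v\<in>?S - {w}. p v * eval_word f1 f2 v (?U w) = 0"
    proof
      fix v assume "v \<in> ?S - {w}"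
      then have "?U v \<prec> ?U w" using max'[of v] by auto
      then have "\<not> (?U w = ?U v \<or> ?U w \<prec> ?U v)" using irrefl[of "?U w"] trans[of "?U w" "?U v" "?U w"] by metis
      then show "p v * eval_word f1 f2 v (?U w) = 0"
        using lead'[of v] unfolding leading_def by auto
    qed
  qed (use w in auto)
  then have "nc_hom f1 f2 p (?U w) \<noteq> 0"
    using w lead'[of w] by (simp add: nc_hom_def leading_def)
  moreover have "z = ?U w \<or> z \<prec> ?U w" if nz: "nc_hom f1 f2 p z \<noteq> 0" for z
  proof -
    obtain v where "p v * eval_word f1 f2 v z \<noteq> 0"
      using nz unfolding nc_hom_def by (rule sum.not_neutral_contains_not_neutral)
    then have "p v \<noteq> 0" "z = ?U v \<or> z \<prec> ?U v"
      using lead'[of v] unfolding leading_def by auto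
    then show ?thesis using max'[of v] trans[of z "?U v" "?U w"] by blast
  qed
  ultimately show thesis
    by (intro that[of w]) (auto simp: leading_def)
qed

text \<open>By surjectivity each variable is the image of some \<open>p\<close>, so its word
  \<open>[a]\<close> is a concatenation of copies of \<open>u1\<close> and \<open>u2\<close>. As
  both are nonempty, one of them is \<open>[a]\<close>.\<close>

lemma leading_words_of_automorphism:
  assumes aut: "(f1, f2) \<in> AutFree" and lead: "leading f1 u1" "leading f2 u2"
    and nc: "u1 @ u2 \<noteq> u2 @ u1"
  shows "u1 = [X1] \<and> u2 = [X2] \<or> u1 = [X2] \<and> u2 = [X1]"
proof -
  have ne: "u1 \<noteq> []" "u2 \<noteq> []" using nc by auto
  have "u1 = [a] \<or> u2 = [a]" for a
  proof -
    have "nc_hom f1 f2 ` ncA = ncA" using aut by (simp add: AutFree_def bij_betw_def)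
    then obtain p where p: "p \<in> ncA" "nc_hom f1 f2 p = nc_var a"
      using ncA_var by (metis imageE)
    have "nc_hom f1 f2 p [a] \<noteq> 0" using p by (simp add: nc_var_def)
    then have "p \<noteq> (\<lambda>w. 0)" by (auto simp: nc_hom_def)
    then obtain w where "leading (nc_hom f1 f2 p) (subst_word u1 u2 w)"
      using leading_nc_hom[OF lead nc p(1)] by blast
    moreover have "leading (nc_var a) [a]"
      by (simp add: leading_def nc_var_def)
    ultimately have "subst_word u1 u2 w = [a]"
      using p(2) leading_unique by metis
    then show ?thesis using ne
      by (cases w; cases "hd w") (auto simp: append_eq_Cons_conv)
  qed
  from this[of X1] this[of X2] show ?thesis by auto
qed

end

section \<open>Weight orders and braid-compatible supports\<close>

lemma count_list_X1_X2: "count_list w X1 + count_list w X2 = length w"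
proof (induction w)
  case (Cons a w)
  then show ?case by (cases a) auto
qed simp

text \<open>The word read in binary with digits X1 = 0 and X2 = 1. On words of equal length this is
  the lexicographic order, in a form where concatenation becomes arithmetic.\<close>

fun word_value :: "var list \<Rightarrow> nat" where
  "word_value [] = 0"
| "word_value (a # w) = (if a = X2 then 2 ^ length w else 0) + word_value w"

lemma word_value_append: "word_value (u @ v) = word_value u * 2 ^ length v + word_value v"
  by (induction u) (auto simp: power_add algebra_simps)

lemma word_value_less: "word_value w < 2 ^ length w"
  by (induction w) auto

lemma word_value_inj: "length u = length v \<Longrightarrow> word_value u = word_value v \<Longrightarrow> u = v"
proof (induction u v rule: list_induct2)
  case (Cons a u b v)
  then show ?case
    using word_value_less[of u] word_value_less[of v] by (cases a; cases b) auto
qed simp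

definition weight :: "real \<Rightarrow> var list \<Rightarrow> real" where
  "weight \<mu> w = real (count_list w X1) + \<mu> * real (count_list w X2)"

lemma weight_append [simp]: "weight \<mu> (u @ v) = weight \<mu> u + weight \<mu> v"
  by (simp add: weight_def algebra_simps)

text \<open>Equal weight and equal number of \<open>X2\<close> force equal length, where
  \<open>word_value\<close> is injective; so the order is total for every real \<mu>. Ranking more
  letters \<open>X2\<close> higher is essential in \<open>x2_graded_automorphism\<close>: a word
  tied with a variable but containing more \<open>X2\<close> must win.\<close>

definition weight_less :: "real \<Rightarrow> var list \<Rightarrow> var list \<Rightarrow> bool" where
  "weight_less \<mu> u v \<longleftrightarrow> weight \<mu> u < weight \<mu> v \<or> weight \<mu> u = weight \<mu> v \<and>
     (count_list u X2 < count_list v X2 \<or>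
      count_list u X2 = count_list v X2 \<and> word_value u < word_value v)"

lemma weight_eq_length_eq:
  "weight \<mu> u = weight \<mu> v \<Longrightarrow> count_list u X2 = count_list v X2 \<Longrightarrow> length u = length v"
  by (simp add: weight_def flip: count_list_X1_X2)

global_interpretation weight: word_order "weight_less \<mu>" for \<mu>
proof
  fix u v w
  show "\<not> weight_less \<mu> u u" by (simp add: weight_less_def)
  show "weight_less \<mu> u v \<Longrightarrow> weight_less \<mu> v w \<Longrightarrow> weight_less \<mu> u w"
    unfolding weight_less_def by (elim disjE conjE) linarith+
  show "u \<noteq> v \<Longrightarrow> weight_less \<mu> u v \<or> weight_less \<mu> v u"
    using word_value_inj[of u v] weight_eq_length_eq[of \<mu> u v]
    unfolding weight_less_def by linarith
  show "weight_less \<mu> u v \<Longrightarrow> weight_less \<mu> (w @ u) (w @ v)"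
    using weight_eq_length_eq[of \<mu> u v]
    unfolding weight_less_def by (elim disjE conjE) (simp_all add: word_value_append)
  show "weight_less \<mu> u v \<Longrightarrow> weight_less \<mu> (u @ w) (v @ w)"
    unfolding weight_less_def by (elim disjE conjE) (simp_all add: word_value_append)
qed

lemma leading_weight_le:
  assumes "weight.leading \<mu> f u" "f v \<noteq> 0"
  shows "weight \<mu> v \<le> weight \<mu> u"
  using assms unfolding weight.leading_def weight_less_def by fastforce

lemma leading_count_le:
  assumes "weight.leading \<mu> f u" "f v \<noteq> 0" "weight \<mu> v = weight \<mu> u"
  shows "count_list v X2 \<le> count_list u X2"
  using assms unfolding weight.leading_def weight_less_def by fastforce

section \<open>The bicharacter on supports\<close>

lemma braid_chi_append_left: "braid_chi q (u @ u') v = braid_chi q u v * braid_chi q u' v"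
  by (simp add: braid_chi_def power_add algebra_simps)

lemma braid_chi_append_right: "braid_chi q u (v @ v') = braid_chi q u v * braid_chi q u v'"
  by (simp add: braid_chi_def power_add algebra_simps)

lemma braid_chi_Nil [simp]: "braid_chi q [] v = 1" "braid_chi q u [] = 1"
  by (simp_all add: braid_chi_def)

lemma braid_chi_single [simp]: "braid_chi q [i] [j] = q i j"
  by (cases i; cases j) (simp_all add: braid_chi_def)

lemma braid_chi_concat_replicate:
  "braid_chi q (concat (replicate m z)) (concat (replicate n z)) = braid_chi q z z ^ (m * n)"
proof -
  have "braid_chi q z (concat (replicate n z)) = braid_chi q z z ^ n"
    by (induction n) (simp_all add: braid_chi_append_right)
  then show ?thesis
    by (induction m) (simp_all add: braid_chi_append_left power_add)
qed

definition compatible :: "(var \<Rightarrow> var \<Rightarrow> 'k::field) \<Rightarrow> 'k ncp \<Rightarrow> 'k ncp \<Rightarrow> bool" where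
  "compatible q f1 f2 \<longleftrightarrow>
     (\<forall>i j u v. nc_sub f1 f2 i u \<noteq> 0 \<longrightarrow> nc_sub f1 f2 j v \<noteq> 0 \<longrightarrow> braid_chi q u v = q i j)"

text \<open>\<open>braid_chi\<close> is multiplicative in each argument, so the condition on
  generators spreads letter by letter: first along \<open>v\<close> against one generator, then
  along \<open>u\<close>.\<close>

lemma eval_word_support_chi:
  assumes "compatible q f1 f2" "eval_word f1 f2 u z \<noteq> 0" "eval_word f1 f2 v y \<noteq> 0"
  shows "braid_chi q z y = braid_chi q u v"
proof -
  have single: "braid_chi q b y = braid_chi q [i] v"
    if "nc_sub f1 f2 i b \<noteq> 0" "eval_word f1 f2 v y \<noteq> 0" for i b v y
    using that(2)
  proof (induction v arbitrary: y)
    case Nil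
    then show ?case by (simp add: nc_one_def split: if_splits)
  next
    case (Cons j v)
    from Cons.prems obtain y1 y2 where "y = y1 @ y2" "nc_sub f1 f2 j y1 \<noteq> 0" "eval_word f1 f2 v y2 \<noteq> 0"
      by (auto elim: nc_mult_support)
    then show ?case
      using Cons.IH[of y2] assms(1) that(1) braid_chi_append_right[of q "[i]" "[j]" v]
      unfolding compatible_def by (simp add: braid_chi_append_right)
  qed
  show ?thesis
    using assms(2)
  proof (induction u arbitrary: z)
    case Nil
    then show ?case by (simp add: nc_one_def split: if_splits)
  next
    case (Cons i u)
    from Cons.prems obtain z1 z2 where "z = z1 @ z2" "nc_sub f1 f2 i z1 \<noteq> 0" "eval_word f1 f2 u z2 \<noteq> 0"
      by (auto elim: nc_mult_support)
    then show ?case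
      using Cons.IH[of z2] single[of i z1 v y] assms(3) braid_chi_append_left[of q "[i]" u v]
      by (simp add: braid_chi_append_left)
  qed
qed

lemma tens_hom_eq_sum:
  assumes "finite S" "{x. t x \<noteq> 0} \<subseteq> S"
  shows "tens_hom f1 f2 t (z1, z2)
    = (\<Sum>x\<in>S. t x * eval_word f1 f2 (fst x) z1 * eval_word f1 f2 (snd x) z2)"
  unfolding tens_hom_def prod.case by (rule sum.mono_neutral_left) (use assms in auto)

text \<open>Testing the braiding on a tensor of two variables and comparing one coefficient gives
  compatibility. Conversely, \<open>eval_word_support_chi\<close> makes \<open>braid_chi\<close>
  constant on the support of the image of each pair of words, so the scalar passes through the
  substitution.\<close>

lemma AutBr_iff:
  "(f1, f2) \<in> AutBr q \<longleftrightarrow> (f1, f2) \<in> AutFree \<and> compatible q f1 f2"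
proof
  assume br: "(f1, f2) \<in> AutBr q"
  have "braid_chi q u v = q i j" if nz: "nc_sub f1 f2 i u \<noteq> 0" "nc_sub f1 f2 j v \<noteq> 0" for i j u v
  proof -
    define t :: "'a nct" where "t = (\<lambda>x. if x = ([i], [j]) then 1 else 0)"
    have "t \<in> ncT" by (simp add: ncT_def t_def)
    then have "tens_hom f1 f2 (braid q t) (v, u) = braid q (tens_hom f1 f2 t) (v, u)"
      using br by (simp add: AutBr_def)
    moreover have "tens_hom f1 f2 (braid q t) (v, u) = q i j * nc_sub f1 f2 j v * nc_sub f1 f2 i u"
      by (subst tens_hom_eq_sum[where S = "{([j], [i])}"]) (auto simp: braid_def t_def split: if_splits)
    moreover have "tens_hom f1 f2 t (u, v) = nc_sub f1 f2 i u * nc_sub f1 f2 j v"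
      by (subst tens_hom_eq_sum[where S = "{([i], [j])}"]) (auto simp: t_def split: if_splits)
    ultimately show ?thesis
      using nz by (simp add: braid_def)
  qed
  then show "(f1, f2) \<in> AutFree \<and> compatible q f1 f2"
    using br by (simp add: AutBr_def compatible_def)
next
  assume *: "(f1, f2) \<in> AutFree \<and> compatible q f1 f2"
  let ?E = "eval_word f1 f2"
  have "tens_hom f1 f2 (braid q t) = braid q (tens_hom f1 f2 t)" if "t \<in> ncT" for t
  proof
    fix z :: "var list \<times> var list"
    obtain z1 z2 where z: "z = (z1, z2)" by fastforce
    let ?S = "{x. t x \<noteq> 0}"
    have fin: "finite ?S" using that by (simp add: ncT_def)
    have "tens_hom f1 f2 (braid q t) z
        = (\<Sum>x\<in>prod.swap ` ?S. braid q t x * ?E (fst x) z1 * ?E (snd x) z2)"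
      unfolding z
    proof (rule tens_hom_eq_sum)
      show "{x. braid q t x \<noteq> 0} \<subseteq> prod.swap ` ?S"
        by (force simp: braid_def image_iff)
    qed (use fin in simp)
    also have "\<dots> = (\<Sum>x\<in>?S. braid_chi q (fst x) (snd x) * t x * ?E (snd x) z1 * ?E (fst x) z2)"
      by (subst sum.reindex) (auto simp: braid_def case_prod_beta)
    also have "\<dots> = (\<Sum>x\<in>?S. braid_chi q z2 z1 * (t x * ?E (fst x) z2 * ?E (snd x) z1))"
    proof (rule sum.cong[OF refl])
      fix x
      show "braid_chi q (fst x) (snd x) * t x * ?E (snd x) z1 * ?E (fst x) z2
          = braid_chi q z2 z1 * (t x * ?E (fst x) z2 * ?E (snd x) z1)"
        using eval_word_support_chi[of q f1 f2 "fst x" z2 "snd x" z1] *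
        by (cases "?E (fst x) z2 = 0 \<or> ?E (snd x) z1 = 0") auto
    qed
    also have "\<dots> = braid q (tens_hom f1 f2 t) z"
      by (simp add: z braid_def tens_hom_def sum_distrib_left)
    finally show "tens_hom f1 f2 (braid q t) z = braid q (tens_hom f1 f2 t) z" .
  qed
  then show "(f1, f2) \<in> AutBr q"
    using * by (simp add: AutBr_def)
qed

lemma sign_power:
  assumes "e = 1 \<or> e = (-1 :: 'a::ring_1)" shows "e ^ n = (if odd n then e else 1)"
  using assms by auto

lemma involutive_values:
  assumes "involutive_braiding (q :: var \<Rightarrow> var \<Rightarrow> 'k::field)"
  shows "q X1 X1 = 1 \<or> q X1 X1 = -1" "q X2 X2 = 1 \<or> q X2 X2 = -1" "q X1 X2 * q X2 X1 = 1"
  using assms by (auto simp: involutive_braiding_def power2_eq_1_iff)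

lemma braid_chi_self:
  assumes "involutive_braiding (q :: var \<Rightarrow> var \<Rightarrow> 'k::field)"
  shows "braid_chi q z z = 1 \<or> braid_chi q z z = -1"
proof -
  have "braid_chi q z z = q X1 X1 ^ (count_list z X1 * count_list z X1) *
      (q X1 X2 * q X2 X1) ^ (count_list z X1 * count_list z X2) *
      q X2 X2 ^ (count_list z X2 * count_list z X2)"
    by (simp add: braid_chi_def power_mult_distrib mult_ac)
  then show ?thesis
    using involutive_values[OF assms] by (auto simp: sign_power)
qed

text \<open>Write the words as z^m and z^n and let e = \<open>braid_chi q z z\<close>, a sign. Then
  q11, q12, q22 are e^(m*m), e^(m*n), e^(n*n). If m or n is even, the first alternative holds; if
  both are odd, all three equal e.\<close>

lemma compatible_leading_commute:
  assumes inv: "involutive_braiding (q :: var \<Rightarrow> var \<Rightarrow> 'k::field)" and comp: "compatible q f1 f2"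
    and nz: "f1 u1 \<noteq> 0" "f2 u2 \<noteq> 0" and comm: "u1 @ u2 = u2 @ u1"
  shows "q X1 X2 = 1 \<and> (q X1 X1 = 1 \<or> q X2 X2 = 1) \<or> q X1 X1 = q X2 X2 \<and> q X1 X2 = q X1 X1"
proof -
  obtain z m n where u: "u1 = concat (replicate m z)" "u2 = concat (replicate n z)"
    using commuting_words_powers[OF comm] .
  have sub: "nc_sub f1 f2 X1 u1 \<noteq> 0" "nc_sub f1 f2 X2 u2 \<noteq> 0"
    using nz by (auto simp: nc_sub_def)
  have "braid_chi q u1 u1 = q X1 X1" "braid_chi q u1 u2 = q X1 X2" "braid_chi q u2 u2 = q X2 X2"
    using comp sub unfolding compatible_def by blast+
  then show ?thesis
    using braid_chi_self[OF inv, of z]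
    by (auto simp: u braid_chi_concat_replicate sign_power split: if_splits)
qed

definition scaled_var :: "'k::field \<Rightarrow> var \<Rightarrow> 'k ncp" where
  "scaled_var c a = (\<lambda>w. c * nc_var a w)"

lemma scaled_var_eqI:
  assumes "\<And>w. f w \<noteq> 0 \<Longrightarrow> w = [a]" shows "f = scaled_var (f [a]) a"
  using assms by (force simp: scaled_var_def nc_var_def)

text \<open>For \<mu> = 1 the weight is the length, so leading words that are variables confine the
  supports to length at most 1. The first excluded pattern then forbids constant terms, the second
  forbids both variables in one component, and together they forbid commuting leading words.\<close>

lemma nondegenerate_AutBr:
  assumes inv: "involutive_braiding (q :: var \<Rightarrow> var \<Rightarrow> 'k::field)"
    and nd: "\<not> (q X1 X2 = 1 \<and> (q X1 X1 = 1 \<or> q X2 X2 = 1))" "\<not> (q X1 X1 = q X2 X2 \<and> q X1 X2 = q X1 X1)"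
    and br: "(f1, f2) \<in> AutBr q"
  obtains a c d where "c \<noteq> 0" "d \<noteq> 0" "f1 = scaled_var c a" "f2 = scaled_var d (swap_var a)"
proof -
  have aut: "(f1, f2) \<in> AutFree" and comp: "compatible q f1 f2"
    using br AutBr_iff[of _ _ q] by auto
  have chi: "braid_chi q u v = q i j" if "nc_sub f1 f2 i u \<noteq> 0" "nc_sub f1 f2 j v \<noteq> 0" for i j u v
    using comp that unfolding compatible_def by blast
  have ncA: "f1 \<in> ncA" "f2 \<in> ncA" using aut by (auto simp: AutFree_def)
  have nz: "f1 \<noteq> (\<lambda>w. 0)" "f2 \<noteq> (\<lambda>w. 0)"
    using AutFree_nonzero[OF aut, of X1] AutFree_nonzero[OF aut, of X2] by (auto simp: nc_sub_def)
  obtain u1 where u1: "weight.leading 1 f1 u1" using weight.leading_exists ncA nz by blast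
  obtain u2 where u2: "weight.leading 1 f2 u2" using weight.leading_exists ncA nz by blast
  have lnz: "f1 u1 \<noteq> 0" "f2 u2 \<noteq> 0" using u1 u2 by (auto simp: weight.leading_def)
  have "u1 @ u2 \<noteq> u2 @ u1"
    using compatible_leading_commute[OF inv comp lnz] nd by blast
  then obtain a where a: "u1 = [a]" "u2 = [swap_var a]"
    using weight.leading_words_of_automorphism[OF aut u1 u2] by (metis swap_var.simps)
  have len: "weight 1 w = length w" for w
    by (simp add: weight_def flip: count_list_X1_X2)
  have short: "length w \<le> 1" if "nc_sub f1 f2 i w \<noteq> 0" for i w
    using that leading_weight_le[OF u1, of w] leading_weight_le[OF u2, of w] a
    by (auto simp: len nc_sub_def split: if_splits)
  have a_nz: "nc_sub f1 f2 X1 [a] \<noteq> 0" "nc_sub f1 f2 X2 [swap_var a] \<noteq> 0"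
    using lnz a by (auto simp: nc_sub_def)
  have notNil: "nc_sub f1 f2 i [] = 0" for i
  proof (rule ccontr)
    assume i: "nc_sub f1 f2 i [] \<noteq> 0"
    have "q i i = 1" "q i X2 = 1" "q X1 i = 1"
      using chi[OF i i] chi[OF i a_nz(2)] chi[OF a_nz(1) i] by simp_all
    then show False using nd(1) by (cases i) auto
  qed
  have notboth: "nc_sub f1 f2 i [X1] = 0 \<or> nc_sub f1 f2 i [X2] = 0" for i
  proof (rule ccontr)
    assume "\<not> ?thesis"
    then have *: "nc_sub f1 f2 i [X1] \<noteq> 0" "nc_sub f1 f2 i [X2] \<noteq> 0" by auto
    show False
      using chi[OF *(1,1)] chi[OF *(2,2)] chi[OF *(1,2)] nd(2) by auto
  qed
  have only: "w = [b]" if b: "nc_sub f1 f2 i [b] \<noteq> 0" and w: "nc_sub f1 f2 i w \<noteq> 0" for i b w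
  proof -
    have "w \<noteq> []" using w notNil by auto
    then obtain c where "w = [c]" using short[OF w] by (cases w) auto
    then show ?thesis using b w notboth[of i] by (cases b; cases c) auto
  qed
  have "f1 = scaled_var (f1 [a]) a"
    using only[of X1 a] a_nz by (intro scaled_var_eqI) (auto simp: nc_sub_def)
  moreover have "f2 = scaled_var (f2 [swap_var a]) (swap_var a)"
    using only[of X2 "swap_var a"] a_nz by (intro scaled_var_eqI) (auto simp: nc_sub_def)
  ultimately show thesis
    using that lnz a by blast
qed

section \<open>Monomial automorphisms\<close>

lemma one_neq_minus_one: "(2 :: 'a::ring_1) \<noteq> 0 \<Longrightarrow> (1 :: 'a) \<noteq> -1"
  by (metis add.right_inverse one_add_one)

text \<open>\<open>D\<close> parametrizes \<open>G\<close> by \<open>H\<close> and \<open>h\<close>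
  reads the parameters off. Everything is checked on explicit parameters, with the composition law
  computed only for elements \<open>D x\<close>.\<close>

lemma is_iso_by_section:
  assumes in_G: "\<And>x. x \<in> carrier H \<Longrightarrow> D x \<in> carrier G"
    and surj: "\<And>g. g \<in> carrier G \<Longrightarrow> \<exists>x\<in>carrier H. g = D x"
    and retract: "\<And>x. x \<in> carrier H \<Longrightarrow> h (D x) = x"
    and mult: "\<And>x y. x \<in> carrier H \<Longrightarrow> y \<in> carrier H \<Longrightarrow> D x \<otimes>\<^bsub>G\<^esub> D y = D (x \<otimes>\<^bsub>H\<^esub> y)"
    and closed: "\<And>x y. x \<in> carrier H \<Longrightarrow> y \<in> carrier H \<Longrightarrow> x \<otimes>\<^bsub>H\<^esub> y \<in> carrier H"
  shows "G \<cong> H"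
proof -
  have "h \<in> iso G H"
    unfolding iso_def hom_def
  proof (intro CollectI conjI ballI)
    show "h \<in> carrier G \<rightarrow> carrier H"
      using surj retract by fastforce
    show "bij_betw h (carrier G) (carrier H)"
      by (rule bij_betw_byWitness[where f' = D]) (use surj retract in_G in fastforce)+
    fix f g assume "f \<in> carrier G" "g \<in> carrier G"
    then obtain x y where "x \<in> carrier H" "f = D x" "y \<in> carrier H" "g = D y"
      using surj by metis
    then show "h (f \<otimes>\<^bsub>G\<^esub> g) = h f \<otimes>\<^bsub>H\<^esub> h g"
      using retract closed mult by simp
  qed
  then show ?thesis by (auto simp: is_iso_def)
qed

lemma scaled_var_in_ncA [simp]: "scaled_var c a \<in> ncA"
  unfolding scaled_var_def by (rule ncA_scale) simp

lemma scaled_var_one [simp]: "scaled_var 1 a = nc_var a"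
  by (simp add: scaled_var_def)

lemma scaled_var_apply: "scaled_var c a [b] = (if a = b then c else 0)"
  by (auto simp: scaled_var_def nc_var_def)

lemma scaled_var_support: "scaled_var c a w \<noteq> 0 \<Longrightarrow> w = [a]"
  by (auto simp: scaled_var_def nc_var_def split: if_splits)

lemma nc_hom_scaled_var: "nc_hom f1 f2 (scaled_var c a) = (\<lambda>w. c * nc_sub f1 f2 a w)"
  unfolding scaled_var_def by (rule ext) (simp add: nc_hom_scale)

lemma nc_hom_scaled_vars [simp]:
  "nc_hom (scaled_var c a) (scaled_var d b) (scaled_var e X1) = scaled_var (e * c) a"
  "nc_hom (scaled_var c a) (scaled_var d b) (scaled_var e X2) = scaled_var (e * d) b"
  unfolding nc_hom_scaled_var by (simp_all add: nc_sub_def scaled_var_def mult.assoc)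

lemma scaled_vars_in_AutFree:
  assumes "c \<noteq> 0" "d \<noteq> 0"
  shows "(scaled_var c a, scaled_var d (swap_var a)) \<in> AutFree"
proof (cases a)
  case X1
  show ?thesis
    unfolding X1
    by (rule AutFree_if_inverse[of _ _ "scaled_var (1 / c) X1" "scaled_var (1 / d) X2"])
       (use assms in \<open>simp_all add: aut_comp_def\<close>)
next
  case X2
  show ?thesis
    unfolding X2
    by (rule AutFree_if_inverse[of _ _ "scaled_var (1 / d) X2" "scaled_var (1 / c) X1"])
       (use assms in \<open>simp_all add: aut_comp_def\<close>)
qed

lemma scaled_vars_in_AutBr:
  assumes "c \<noteq> 0" "d \<noteq> 0"
    and "q a a = q X1 X1" "q a (swap_var a) = q X1 X2" "q (swap_var a) a = q X2 X1"
      "q (swap_var a) (swap_var a) = q X2 X2"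
  shows "(scaled_var c a, scaled_var d (swap_var a)) \<in> AutBr q"
proof -
  have "braid_chi q u v = q i j"
    if "nc_sub (scaled_var c a) (scaled_var d (swap_var a)) i u \<noteq> 0"
      "nc_sub (scaled_var c a) (scaled_var d (swap_var a)) j v \<noteq> 0" for i j u v
    using that assms
    by (cases i; cases j) (auto simp: nc_sub_def dest!: scaled_var_support)
  then show ?thesis
    using assms scaled_vars_in_AutFree by (simp add: AutBr_iff compatible_def)
qed

section \<open>Constant braidings and groups of monomial automorphisms\<close>

lemma AutBr_trivial_braiding:
  assumes "\<And>i j. q i j = 1"
  shows "AutBr q = AutFree"
proof -
  have "compatible q f1 f2" for f1 f2
    using assms by (simp add: compatible_def braid_chi_def)
  then show ?thesis
    using AutBr_iff[of _ _ q] by auto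
qed

lemma AutBr_sign_braiding:
  assumes "(2 :: 'k::field) \<noteq> 0" and q: "\<And>i j. q i j = (-1 :: 'k)"
  shows "AutBr q = Godd"
proof -
  have neq: "(1 :: 'k) \<noteq> -1" using assms(1) by (rule one_neq_minus_one)
  have chi: "braid_chi q u v = (-1) ^ (length u * length v)" for u v
    by (simp add: braid_chi_def q flip: power_add count_list_X1_X2) (simp add: algebra_simps)
  have "compatible q f1 f2 \<longleftrightarrow> odd_part f1 \<and> odd_part f2" for f1 f2
  proof
    assume comp: "compatible q f1 f2"
    have "odd (length w)" if "nc_sub f1 f2 i w \<noteq> 0" for i w
    proof -
      have "(-1 :: 'k) ^ (length w * length w) = -1"
        using comp that unfolding compatible_def chi q by blast
      then show ?thesis using neq by (cases "even (length w)") auto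
    qed
    from this[of X1] this[of X2] show "odd_part f1 \<and> odd_part f2"
      by (auto simp: odd_part_def nc_sub_def)
  next
    assume "odd_part f1 \<and> odd_part f2"
    then have "odd (length w)" if "nc_sub f1 f2 i w \<noteq> 0" for i w
      using that by (auto simp: odd_part_def nc_sub_def split: if_splits)
    then show "compatible q f1 f2"
      by (simp add: compatible_def chi q)
  qed
  then show ?thesis
    using AutBr_iff[of _ _ q] by (auto simp: Godd_def)
qed

lemma AutBr_swap_iso:
  assumes char: "(2 :: 'k::field) \<noteq> 0" and inv: "involutive_braiding (q :: var \<Rightarrow> var \<Rightarrow> 'k)"
    and q: "q X1 X1 = q X2 X2" "q X1 X2 = q X2 X1" "q X1 X1 * q X1 X2 = -1"
  shows "aut_group (AutBr q) \<cong> (units2_swap :: (('k \<times> 'k) \<times> bool) monoid)"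
proof -
  have neq: "(1 :: 'k) \<noteq> -1" using char by (rule one_neq_minus_one)
  define D :: "('k \<times> 'k) \<times> bool \<Rightarrow> 'k ncp \<times> 'k ncp" where
    \<comment> \<open>The units are indexed by the variable that they multiply, not by the component
      in which they occur. With \<open>aut_comp\<close>, a swap on the left then exchanges the units
      of the right factor, as \<open>units2_swap\<close> prescribes.\<close>
    "D = (\<lambda>((a, b), s). if s then (scaled_var b X2, scaled_var a X1) else (scaled_var a X1, scaled_var b X2))"
  define h :: "'k ncp \<times> 'k ncp \<Rightarrow> ('k \<times> 'k) \<times> bool" where
    "h = (\<lambda>(f1, f2). if f1 [X1] \<noteq> 0 then ((f1 [X1], f2 [X2]), False) else ((f2 [X1], f1 [X2]), True))"
  let ?C = "carrier (units2_swap :: (('k \<times> 'k) \<times> bool) monoid)"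
  have hD: "h (D x) = x" if "x \<in> ?C" for x
    using that by (auto simp: units2_swap_def D_def h_def scaled_var_apply)
  have D_in: "D x \<in> AutBr q" if "x \<in> ?C" for x
    using that scaled_vars_in_AutBr[of _ _ q X1] scaled_vars_in_AutBr[of _ _ q X2] q
    by (auto simp: units2_swap_def D_def)
  have D_surj: "\<exists>x\<in>?C. f = D x" if br: "f \<in> AutBr q" for f
  proof -
    obtain f1 f2 where f: "f = (f1, f2)" by fastforce
    have nd1: "\<not> (q X1 X2 = 1 \<and> (q X1 X1 = 1 \<or> q X2 X2 = 1))" using q neq by auto
    have nd2: "\<not> (q X1 X1 = q X2 X2 \<and> q X1 X2 = q X1 X1)"
      using q(3) involutive_values(1)[OF inv] neq by auto
    obtain a c d where *: "c \<noteq> 0" "d \<noteq> 0" "f1 = scaled_var c a" "f2 = scaled_var d (swap_var a)"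
      using nondegenerate_AutBr[OF inv nd1 nd2 br[unfolded f]] .
    show ?thesis
    proof (cases a)
      case X1
      then show ?thesis using * f by (intro bexI[of _ "((c, d), False)"]) (auto simp: units2_swap_def D_def)
    next
      case X2
      then show ?thesis using * f by (intro bexI[of _ "((d, c), True)"]) (auto simp: units2_swap_def D_def)
    qed
  qed
  show ?thesis
  proof (rule is_iso_by_section[of _ D _ h])
    fix x y assume "x \<in> ?C" "y \<in> ?C"
    then show "x \<otimes>\<^bsub>units2_swap\<^esub> y \<in> ?C"
      and "D x \<otimes>\<^bsub>aut_group (AutBr q)\<^esub> D y = D (x \<otimes>\<^bsub>units2_swap\<^esub> y)"
      by (auto simp: units2_swap_def D_def aut_group_def aut_comp_def mult.commute split: if_splits)
  qed (use D_in D_surj hD in \<open>auto simp: aut_group_def\<close>)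
qed

lemma AutBr_diagonal_iso:
  assumes char: "(2 :: 'k::field) \<noteq> 0" and inv: "involutive_braiding (q :: var \<Rightarrow> var \<Rightarrow> 'k)"
    and q: "(q X1 X2 \<noteq> 1 \<and> q X1 X2 \<noteq> -1) \<or> (q X1 X2 = -1 \<and> q X1 X1 * q X2 X2 = -1)"
  shows "aut_group (AutBr q) \<cong> (units2 :: ('k \<times> 'k) monoid)"
proof -
  have neq: "(1 :: 'k) \<noteq> -1" using char by (rule one_neq_minus_one)
  define D :: "'k \<times> 'k \<Rightarrow> 'k ncp \<times> 'k ncp" where
    "D = (\<lambda>(a, b). (scaled_var a X1, scaled_var b X2))"
  define h :: "'k ncp \<times> 'k ncp \<Rightarrow> 'k \<times> 'k" where "h = (\<lambda>(f1, f2). (f1 [X1], f2 [X2]))"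
  let ?C = "carrier (units2 :: ('k \<times> 'k) monoid)"
  have hD: "h (D x) = x" for x
    by (auto simp: D_def h_def scaled_var_apply split: prod.splits)
  have D_in: "D x \<in> AutBr q" if "x \<in> ?C" for x
    using that scaled_vars_in_AutBr[of _ _ q X1] by (auto simp: units2_def D_def)
  have D_surj: "\<exists>x\<in>?C. f = D x" if br: "f \<in> AutBr q" for f
  proof -
    obtain f1 f2 where f: "f = (f1, f2)" by fastforce
    have nd1: "\<not> (q X1 X2 = 1 \<and> (q X1 X1 = 1 \<or> q X2 X2 = 1))" using q neq by auto
    have nd2: "\<not> (q X1 X1 = q X2 X2 \<and> q X1 X2 = q X1 X1)"
      using q involutive_values(1)[OF inv] neq by auto
    obtain a c d where *: "c \<noteq> 0" "d \<noteq> 0" "f1 = scaled_var c a" "f2 = scaled_var d (swap_var a)"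
      using nondegenerate_AutBr[OF inv nd1 nd2 br[unfolded f]] .
    \<comment> \<open>An exchange of the variables would force q12 = q21 and q11 = q22. Then q12
      squared is 1, which leaves q12 = -1, and there the product q11 q22 would be 1 rather than
      -1.\<close>
    have "a = X1"
    proof (rule ccontr)
      assume "a \<noteq> X1"
      then have a: "a = X2" by (cases a) auto
      have "compatible q f1 f2" using br f AutBr_iff[of _ _ q] by simp
      moreover have "nc_sub f1 f2 X1 [X2] \<noteq> 0" "nc_sub f1 f2 X2 [X1] \<noteq> 0"
        using * a by (auto simp: nc_sub_def scaled_var_apply)
      ultimately have "braid_chi q [X2] [X1] = q X1 X2" "braid_chi q [X2] [X2] = q X1 X1"
        unfolding compatible_def by blast+
      then have "q X2 X1 = q X1 X2" "q X2 X2 = q X1 X1" by simp_all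
      then show False
        using q involutive_values[OF inv] neq by (auto simp: square_eq_1_iff)
    qed
    then show ?thesis using * f by (intro bexI[of _ "(c, d)"]) (auto simp: units2_def D_def)
  qed
  show ?thesis
  proof (rule is_iso_by_section[of _ D _ h])
    fix x y assume "x \<in> ?C" "y \<in> ?C"
    then show "x \<otimes>\<^bsub>units2\<^esub> y \<in> ?C"
      and "D x \<otimes>\<^bsub>aut_group (AutBr q)\<^esub> D y = D (x \<otimes>\<^bsub>units2\<^esub> y)"
      by (auto simp: units2_def D_def aut_group_def aut_comp_def mult.commute)
  qed (use D_in D_surj hD in \<open>auto simp: aut_group_def\<close>)
qed

section \<open>The triangular case\<close>

text \<open>The elements of K[x2^2], recognised by their support. This replaces the polynomial in
  \<open>G4\<close>, since sums, rescalings and supports of automorphisms are easier to treat in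
  this form.\<close>

definition x2_even :: "('k::field) ncp \<Rightarrow> bool" where
  "x2_even H \<longleftrightarrow> H \<in> ncA \<and> (\<forall>w. H w \<noteq> 0 \<longrightarrow> (\<exists>k. w = replicate (2 * k) X2))"

lemma nc_mult_word_words:
  "nc_mult (\<lambda>z. if z = u then 1 else 0) (\<lambda>z. if z = v then 1 else 0 :: 'k::field)
    = (\<lambda>z. if z = u @ v then 1 else 0)"
  using eval_word_append[of "nc_var X1 :: 'k ncp" "nc_var X2" u v] by (simp add: eval_word_vars)

lemma nc_pow_word:
  "nc_pow (\<lambda>z. if z = u then 1 else 0 :: 'k::field) n
    = (\<lambda>z. if z = concat (replicate n u) then 1 else 0)"
proof (induction n)
  case 0
  then show ?case by (auto simp: nc_pow_def nc_one_def)
next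
  case (Suc n)
  then show ?case by (simp add: nc_pow_def nc_mult_word_words)
qed

lemma concat_replicate_replicate: "concat (replicate n (replicate m a)) = replicate (m * n) a"
  by (induction n) (simp_all add: replicate_add)

lemma nc_pow_x2_squared:
  "nc_pow (nc_pow (nc_var X2) 2) k = (\<lambda>z. if z = replicate (2 * k) X2 then 1 else 0 :: 'k::field)"
proof -
  have "concat (replicate 2 [X2]) = replicate 2 X2" by (simp add: numeral_2_eq_2)
  then show ?thesis
    by (simp only: nc_var_def nc_pow_word concat_replicate_replicate)
qed

lemma nc_poly_eval_x2_squared:
  "nc_poly_eval g (nc_pow (nc_var X2) 2) w
    = (\<Sum>k\<le>degree g. if w = replicate (2 * k) X2 then coeff g k else 0)"
  unfolding nc_poly_eval_def nc_pow_x2_squared by (rule sum.cong) auto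

lemma x2_even_nc_poly_eval: "x2_even (nc_poly_eval g (nc_pow (nc_var X2) 2))"
proof -
  have supp: "\<exists>k\<le>degree g. w = replicate (2 * k) X2"
    if "nc_poly_eval g (nc_pow (nc_var X2) 2) w \<noteq> 0" for w
    using that unfolding nc_poly_eval_x2_squared
    by (rule sum.not_neutral_contains_not_neutral) (auto split: if_splits)
  then have "{w. nc_poly_eval g (nc_pow (nc_var X2) 2) w \<noteq> 0}
      \<subseteq> (\<lambda>k. replicate (2 * k) X2) ` {..degree g}"
    by auto
  then have "nc_poly_eval g (nc_pow (nc_var X2) 2) \<in> ncA"
    unfolding ncA_def by (auto intro: finite_subset)
  then show ?thesis using supp unfolding x2_even_def by blast
qed

lemma ncA_length_bound:
  assumes "f \<in> ncA"
  obtains N where "\<And>w. f w \<noteq> 0 \<Longrightarrow> length w \<le> N"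
proof -
  have "finite (length ` {w. f w \<noteq> 0})" using assms by (simp add: ncA_def)
  then show thesis using that unfolding finite_nat_set_iff_bounded_le by auto
qed

lemma x2_even_is_nc_poly_eval:
  assumes "x2_even H"
  obtains g where "H = nc_poly_eval g (nc_pow (nc_var X2) 2)"
proof -
  obtain N where N: "\<And>w. H w \<noteq> 0 \<Longrightarrow> length w \<le> N"
    using ncA_length_bound assms unfolding x2_even_def by blast
  define g where "g = Abs_poly (\<lambda>k. H (replicate (2 * k) X2))"
  have g: "coeff g k = H (replicate (2 * k) X2)" for k
  proof -
    have "H (replicate (2 * k) X2) = 0" if "k > N" for k
      using N[of "replicate (2 * k) X2"] that by fastforce
    then show ?thesis unfolding g_def by (subst coeff_Abs_poly[of N]) auto
  qed
  have "H w = nc_poly_eval g (nc_pow (nc_var X2) 2) w" for w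
  proof (cases "\<exists>k. w = replicate (2 * k) X2")
    case True
    then obtain k where k: "w = replicate (2 * k) X2" by blast
    have "(\<Sum>j\<le>degree g. if w = replicate (2 * j) X2 then coeff g j else 0)
        = (\<Sum>j\<le>degree g. if j = k then coeff g j else 0)"
      by (rule sum.cong) (auto simp: k replicate_eq_replicate)
    then show ?thesis
      using coeff_eq_0[of g k] by (auto simp: nc_poly_eval_x2_squared g k)
  next
    case False
    moreover from this have "H w = 0" using assms by (auto simp: x2_even_def)
    ultimately show ?thesis by (simp add: nc_poly_eval_x2_squared)
  qed
  then show thesis using that by blast
qed

lemma G4_eq:
  "G4 = {(\<lambda>w. \<alpha> * nc_var X1 w + H w, scaled_var \<beta> X2) | \<alpha> \<beta> H. \<alpha> \<noteq> 0 \<and> \<beta> \<noteq> 0 \<and> x2_even H}"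
  (is "_ = ?R")
proof
  show "G4 \<subseteq> ?R"
    unfolding G4_def scaled_var_def using x2_even_nc_poly_eval by blast
  show "?R \<subseteq> G4"
  proof
    fix \<phi> assume "\<phi> \<in> ?R"
    then obtain \<alpha> \<beta> H where *: "\<phi> = (\<lambda>w. \<alpha> * nc_var X1 w + H w, scaled_var \<beta> X2)"
      "\<alpha> \<noteq> 0" "\<beta> \<noteq> 0" "x2_even H" by blast
    moreover obtain g where "H = nc_poly_eval g (nc_pow (nc_var X2) 2)"
      using x2_even_is_nc_poly_eval[OF *(4)] .
    ultimately show "\<phi> \<in> G4" unfolding G4_def scaled_var_def by blast
  qed
qed

lemma nc_mult_scale: "nc_mult (\<lambda>w. c * f w) (\<lambda>w. d * g w) = (\<lambda>w. c * d * nc_mult f g w)"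
  by (rule ext) (simp add: nc_mult_def sum_distrib_left mult_ac)

lemma eval_word_x2_power:
  "eval_word f1 (scaled_var \<beta> X2) (replicate n X2)
    = (\<lambda>z. \<beta> ^ n * (if z = replicate n X2 then 1 else 0 :: 'k::field))"
proof (induction n)
  case 0
  then show ?case by (auto simp: nc_one_def)
next
  case (Suc n)
  then show ?case
    by (simp add: nc_sub_def scaled_var_def nc_var_def nc_mult_scale nc_mult_word_words)
qed

lemma nc_hom_x2_even:
  assumes "x2_even H"
  shows "nc_hom f1 (scaled_var \<beta> X2) H z = \<beta> ^ length z * H z"
proof -
  have fin: "finite {w. H w \<noteq> 0}" using assms by (simp add: x2_even_def ncA_def)
  have "nc_hom f1 (scaled_var \<beta> X2) H z = (\<Sum>w\<in>{w. H w \<noteq> 0}. if z = w then \<beta> ^ length w * H w else 0)"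
    unfolding nc_hom_def
  proof (rule sum.cong[OF refl])
    fix w assume "w \<in> {w. H w \<noteq> 0}"
    then obtain k where "w = replicate (2 * k) X2" using assms by (auto simp: x2_even_def)
    then show "H w * eval_word f1 (scaled_var \<beta> X2) w z = (if z = w then \<beta> ^ length w * H w else 0)"
      by (simp add: eval_word_x2_power)
  qed
  also have "\<dots> = \<beta> ^ length z * H z"
    using fin by (simp add: sum.delta')
  finally show ?thesis .
qed

lemma elementary_comp:
  assumes "x2_even H" "x2_even H'"
  shows "aut_comp (\<lambda>w. \<alpha> * nc_var X1 w + H w, scaled_var \<beta> X2) (\<lambda>w. \<alpha>' * nc_var X1 w + H' w, scaled_var \<beta>' X2)
    = (\<lambda>w. \<alpha>' * \<alpha> * nc_var X1 w + (\<alpha>' * H w + \<beta> ^ length w * H' w), scaled_var (\<beta>' * \<beta>) X2)"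
proof -
  let ?f = "\<lambda>w. \<alpha> * nc_var X1 w + H w"
  have "H' \<in> ncA" using assms by (simp add: x2_even_def)
  then have "nc_hom ?f (scaled_var \<beta> X2) (\<lambda>w. \<alpha>' * nc_var X1 w + H' w) z
      = \<alpha>' * \<alpha> * nc_var X1 z + (\<alpha>' * H z + \<beta> ^ length z * H' z)" for z
    using nc_hom_add_scale[of "nc_var X1" H' ?f "scaled_var \<beta> X2" \<alpha>' 1 z]
    by (simp add: nc_hom_x2_even[OF assms(2)] nc_sub_def algebra_simps)
  moreover have "nc_hom ?f (scaled_var \<beta> X2) (scaled_var \<beta>' X2) = scaled_var (\<beta>' * \<beta>) X2"
    unfolding nc_hom_scaled_var by (simp add: nc_sub_def scaled_var_def mult.assoc)
  ultimately show ?thesis by (simp add: aut_comp_def fun_eq_iff)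
qed

lemma elementary_in_AutFree:
  assumes "\<alpha> \<noteq> 0" "\<beta> \<noteq> 0" and H: "x2_even H"
  shows "(\<lambda>w. \<alpha> * nc_var X1 w + H w, scaled_var \<beta> X2) \<in> AutFree"
proof -
  \<comment> \<open>The solution of
    \<open>1 / \<alpha> * H w + \<beta> ^ length w * H' w = 0\<close>, the condition from
    \<open>elementary_comp\<close> for the composite to have no part in x2.\<close>
  define H' where "H' = (\<lambda>w. - (1 / \<alpha>) * (1 / \<beta>) ^ length w * H w)"
  have "{w. H' w \<noteq> 0} \<subseteq> {w. H w \<noteq> 0}" by (auto simp: H'_def)
  then have H': "x2_even H'"
    using H unfolding x2_even_def ncA_def by (auto intro: finite_subset)
  have ncA: "(\<lambda>w. c * nc_var X1 w + F w) \<in> ncA" if "x2_even F" for c :: 'a and F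
    using that by (intro ncA_add ncA_scale) (auto simp: x2_even_def)
  have "1 / \<alpha> * H w + \<beta> ^ length w * H' w = 0" "\<alpha> * H' w + (1 / \<beta>) ^ length w * H w = 0" for w
    using assms by (simp_all add: H'_def power_one_over)
  then show ?thesis
    by (intro AutFree_if_inverse[of _ _ "\<lambda>w. 1 / \<alpha> * nc_var X1 w + H' w" "scaled_var (1 / \<beta>) X2"])
       (use assms ncA[OF H] ncA[OF H'] in \<open>simp_all only: elementary_comp[OF H H'] elementary_comp[OF H' H]\<close>,
        simp_all)
qed

section \<open>Automorphisms with a parity condition on x2\<close>

lemma count_list_concat_replicate: "count_list (concat (replicate m z)) a = m * count_list z a"
  by (induction m) simp_all

text \<open>Powers of one word have proportional letter counts. In contraposed form, a nonzero 2 by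
  2 determinant of counts certifies that two words do not commute.\<close>

lemma commuting_words_counts:
  assumes "u @ v = v @ u"
  shows "count_list u a * count_list v b = count_list u b * count_list v a"
proof -
  obtain z m n where "u = concat (replicate m z)" "v = concat (replicate n z)"
    using commuting_words_powers[OF assms] .
  then show ?thesis by (simp add: count_list_concat_replicate)
qed

text \<open>Work modulo the words that contain \<open>X2\<close>. There \<open>f2\<close> vanishes,
  and if \<open>f1\<close> were constant there, every image would be constant too, so x1 could not
  be reached.\<close>

lemma automorphism_x2_free_word:
  assumes aut: "(f1, f2) \<in> AutFree" and f2: "\<And>w. f2 w \<noteq> 0 \<Longrightarrow> count_list w X2 \<noteq> 0"
  shows "\<exists>u. f1 u \<noteq> 0 \<and> u \<noteq> [] \<and> count_list u X2 = 0"
proof (rule ccontr)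
  assume nt: "\<not> ?thesis"
  have none: "nc_sub f1 f2 i u = 0" if u: "u \<noteq> []" "count_list u X2 = 0" for i u
    using u f2[of u] nt by (auto simp: nc_sub_def)
  have zero: "eval_word f1 f2 w z = 0" if "z \<noteq> []" "count_list z X2 = 0" for w z
    using that
  proof (induction w arbitrary: z)
    case Nil
    then show ?case by (simp add: nc_one_def)
  next
    case (Cons i w)
    show ?case
    proof (rule ccontr)
      assume "eval_word f1 f2 (i # w) z \<noteq> 0"
      then have "nc_mult (nc_sub f1 f2 i) (eval_word f1 f2 w) z \<noteq> 0" by simp
      then obtain u v where "z = u @ v" "nc_sub f1 f2 i u \<noteq> 0" "eval_word f1 f2 w v \<noteq> 0"
        by (rule nc_mult_support)
      then show False using none[of u i] Cons.IH[of v] Cons.prems by auto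
    qed
  qed
  have "nc_hom f1 f2 ` ncA = ncA" using aut by (simp add: AutFree_def bij_betw_def)
  then obtain p where "nc_hom f1 f2 p = nc_var X1"
    using ncA_var by (metis imageE)
  moreover have "nc_hom f1 f2 p [X1] = 0" by (simp add: nc_hom_def zero)
  ultimately show False by (simp add: nc_var_def)
qed

text \<open>Rotate the weight \<open>(1, \<mu>)\<close> from \<open>\<mu> = -\<infinity>\<close> upwards. For very negative \<open>\<mu>\<close> the leading words are
  \<open>x1\<close> and \<open>x2\<close>. At the first \<open>\<mu>\<close> where one of them is tied with another word, a value \<open>\<mu> \<le> 0\<close> would
  produce leading words with linearly independent degrees other than \<open>x1, x2\<close>.\<close>
lemma x2_graded_automorphism:
  assumes aut: "(f1, f2) \<in> AutFree"
    and even: "\<And>w. f1 w \<noteq> 0 \<Longrightarrow> even (count_list w X2)"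
    and odd: "\<And>w. f2 w \<noteq> 0 \<Longrightarrow> odd (count_list w X2)"
  shows "f1 [X1] \<noteq> 0" "f2 [X2] \<noteq> 0"
    and "\<And>w. f2 w \<noteq> 0 \<Longrightarrow> w = [X2]"
    and "\<And>w. f1 w \<noteq> 0 \<Longrightarrow> w = [X1] \<or> count_list w X1 = 0"
proof -
  let ?a = "\<lambda>w. count_list w X1" and ?b = "\<lambda>w. count_list w X2"
  have ncA: "f1 \<in> ncA" "f2 \<in> ncA" using aut by (auto simp: AutFree_def)
  have nz: "f1 \<noteq> (\<lambda>w. 0)" "f2 \<noteq> (\<lambda>w. 0)"
    using AutFree_nonzero[OF aut, of X1] AutFree_nonzero[OF aut, of X2] by (auto simp: nc_sub_def)
  have b_nz: "?b w \<noteq> 0" if "f2 w \<noteq> 0" for w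
    using odd[OF that] by (rule contrapos_nn) simp
  \<comment> \<open>Parity decides the order of the two variables: \<open>[X2]\<close> cannot occur
    in \<open>f1\<close>.\<close>
  have basic: "u1 = [X1] \<and> u2 = [X2]"
    if "weight.leading \<mu> f1 u1" "weight.leading \<mu> f2 u2" "?a u1 * ?b u2 \<noteq> ?b u1 * ?a u2" for \<mu> u1 u2
  proof -
    have "u1 @ u2 \<noteq> u2 @ u1" using that(3) commuting_words_counts by metis
    moreover have "even (?b u1)" using even that(1) by (simp add: weight.leading_def)
    ultimately show ?thesis
      using weight.leading_words_of_automorphism[OF aut that(1,2)] by auto
  qed
  obtain N1 where N1: "\<And>w. f1 w \<noteq> 0 \<Longrightarrow> length w \<le> N1" using ncA_length_bound ncA by blast
  \<comment> \<open>\<open>M\<close> exceeds the number of \<open>X1\<close> in every word of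
    \<open>f1\<close>. Under the weight \<open>- M\<close> a word of \<open>f1\<close> containing
    \<open>X2\<close> is negative, whereas \<open>p\<close> is positive, so \<open>u1\<close> is
    free of \<open>X2\<close>.\<close>
  define M where "M = real N1 + 1"
  obtain u1 where u1: "weight.leading (- M) f1 u1" using weight.leading_exists ncA nz by blast
  obtain u2 where u2: "weight.leading (- M) f2 u2" using weight.leading_exists ncA nz by blast
  have f12: "f1 u1 \<noteq> 0" "f2 u2 \<noteq> 0" using u1 u2 by (auto simp: weight.leading_def)
  obtain p where p: "f1 p \<noteq> 0" "p \<noteq> []" "?b p = 0"
    using automorphism_x2_free_word[OF aut b_nz] by blast
  have "?a p \<noteq> 0" using p count_list_X1_X2[of p] by auto
  then have pos: "weight (- M) u1 > 0"
    using leading_weight_le[OF u1 p(1)] p(3) by (simp add: weight_def)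
  have b0: "?b u1 = 0"
  proof (rule ccontr)
    assume "?b u1 \<noteq> 0"
    then have "M * 1 \<le> M * real (?b u1)" by (intro mult_left_mono) (auto simp: M_def)
    moreover have "real (?a u1) < M" using N1[OF f12(1)] count_list_X1_X2[of u1] by (simp add: M_def)
    ultimately show False using pos unfolding weight_def by linarith
  qed
  moreover have "?a u1 \<noteq> 0" using pos b0 by (auto simp: weight_def)
  moreover have "?b u2 \<noteq> 0" using b_nz[OF f12(2)] .
  ultimately have u12: "u1 = [X1]" "u2 = [X2]" using basic[OF u1 u2] by auto
  show x1: "f1 [X1] \<noteq> 0" and x2: "f2 [X2] \<noteq> 0" using f12 u12 by auto
  have A1: "?a w \<le> 1" if "f1 w \<noteq> 0" "?b w = 0" for w
    using leading_weight_le[OF u1 that(1)] that(2) u12 by (simp add: weight_def)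
  have A2: "w = [X2]" if w: "f2 w \<noteq> 0" "?b w < 2" for w
  proof -
    have b: "?b w = 1" using odd[OF w(1)] w(2) by (cases "?b w") auto
    then have "?a w = 0" using leading_weight_le[OF u2 w(1)] u12 by (simp add: weight_def)
    then have "length w = 1" using b count_list_X1_X2[of w] by simp
    then show ?thesis using b by (cases w) (auto split: if_splits)
  qed
  \<comment> \<open>The critical values of \<mu>: the solutions of a + \<mu> b = 1 for words of
    \<open>f1\<close> and of a + \<mu> b = \<mu> for words of \<open>f2\<close>, where a and b count
    \<open>X1\<close> and \<open>X2\<close>. By \<open>A1\<close> and \<open>A2\<close> the words
    left out never outweigh x1 or x2.\<close>
  define T where "T = (\<lambda>w. (1 - real (?a w)) / real (?b w)) ` {w. f1 w \<noteq> 0 \<and> ?b w \<noteq> 0}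
    \<union> (\<lambda>w. - real (?a w) / (real (?b w) - 1)) ` {w. f2 w \<noteq> 0 \<and> 2 \<le> ?b w}"
  have "finite T" using ncA unfolding T_def ncA_def by auto
  have T_pos: "t > 0" if "t \<in> T" for t
  proof (rule ccontr)
    assume "\<not> t > 0"
    define \<mu> where "\<mu> = Min T"
    have mu: "\<mu> \<in> T" "\<mu> \<le> 0" and min: "\<And>s. s \<in> T \<Longrightarrow> \<mu> \<le> s"
      using \<open>finite T\<close> that \<open>\<not> t > 0\<close> unfolding \<mu>_def
      by (auto intro: Min_in order.trans[OF Min_le])
    have le1: "weight \<mu> w \<le> 1" if w: "f1 w \<noteq> 0" for w
    proof (cases "?b w = 0")
      case True
      then show ?thesis using A1[OF w] by (simp add: weight_def)
    next
      case False
      then have "\<mu> \<le> (1 - real (?a w)) / real (?b w)" using w by (intro min) (auto simp: T_def)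
      then show ?thesis using False by (simp add: weight_def field_simps)
    qed
    have le2: "weight \<mu> w \<le> \<mu>" if w: "f2 w \<noteq> 0" for w
    proof (cases "2 \<le> ?b w")
      case False
      then show ?thesis using A2[OF w] by (simp add: weight_def)
    next
      case True
      then have "\<mu> \<le> - real (?a w) / (real (?b w) - 1)" using w by (intro min) (auto simp: T_def)
      then show ?thesis using True by (simp add: weight_def field_simps)
    qed
    obtain v1 where v1: "weight.leading \<mu> f1 v1" using weight.leading_exists ncA nz by blast
    obtain v2 where v2: "weight.leading \<mu> f2 v2" using weight.leading_exists ncA nz by blast
    have nz12: "f1 v1 \<noteq> 0" "f2 v2 \<noteq> 0" using v1 v2 by (auto simp: weight.leading_def)
    have w1: "weight \<mu> v1 = 1"
      using le1[OF nz12(1)] leading_weight_le[OF v1 x1] by (simp add: weight_def)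
    have w2: "weight \<mu> v2 = \<mu>"
      using le2[OF nz12(2)] leading_weight_le[OF v2 x2] by (simp add: weight_def)
    \<comment> \<open>Inserting the two weight equations, a vanishing determinant reduces to b(v2) =
      \<mu> b(v1). For \<mu> at most 0 this contradicts the presence of \<open>X2\<close> in
      \<open>v2\<close>.\<close>
    have "?a v1 * ?b v2 \<noteq> ?b v1 * ?a v2"
    proof
      assume "?a v1 * ?b v2 = ?b v1 * ?a v2"
      then have "real (?a v1) * real (?b v2) = real (?b v1) * real (?a v2)"
        by (metis of_nat_mult)
      moreover have "real (?a v1) = 1 - \<mu> * real (?b v1)" "real (?a v2) = \<mu> - \<mu> * real (?b v2)"
        using w1 w2 by (auto simp: weight_def)
      ultimately have "real (?b v2) = \<mu> * real (?b v1)"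
        by (simp add: algebra_simps)
      also have "\<dots> \<le> 0" using mu(2) by (simp add: mult_nonpos_nonneg)
      finally show False using b_nz[OF nz12(2)] by simp
    qed
    then have v12: "v1 = [X1]" "v2 = [X2]" using basic[OF v1 v2] by auto
    \<comment> \<open>Some word attains the minimum and is tied with x1 or x2. It contains more
      letters \<open>X2\<close>, so the tie-break contradicts \<open>v12\<close>.\<close>
    consider w where "f1 w \<noteq> 0" "?b w \<noteq> 0" "\<mu> = (1 - real (?a w)) / real (?b w)"
      | w where "f2 w \<noteq> 0" "2 \<le> ?b w" "\<mu> = - real (?a w) / (real (?b w) - 1)"
      using mu(1) unfolding T_def by blast
    then show False
    proof cases
      case 1
      then have "weight \<mu> w = weight \<mu> v1" unfolding w1 by (simp add: weight_def)
      then show False using leading_count_le[OF v1 1(1)] 1(2) v12 by simp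
    next
      case 2
      then have "\<mu> * (real (?b w) - 1) = - real (?a w)" by simp
      then have "weight \<mu> w = weight \<mu> v2" unfolding w2 by (simp add: weight_def algebra_simps)
      then show False using leading_count_le[OF v2 2(1)] 2(2) v12 by simp
    qed
  qed
  show "w = [X2]" if w: "f2 w \<noteq> 0" for w
  proof (rule ccontr)
    assume "w \<noteq> [X2]"
    then have b: "2 \<le> ?b w" using A2[OF w] by linarith
    \<comment> \<open>A critical value coming from \<open>f2\<close> is never positive, so
      \<open>f2\<close> has no word with two or more \<open>X2\<close>. For \<open>f1\<close>,
      positivity of (1 - a)/b below leaves only a = 0.\<close>
    then have "- real (?a w) / (real (?b w) - 1) > 0" using w by (intro T_pos) (auto simp: T_def)
    then show False using b by (simp add: field_simps)
  qed
  show "w = [X1] \<or> ?a w = 0" if w: "f1 w \<noteq> 0" for w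
  proof (cases "?b w = 0")
    case True
    then have "length w \<le> 1" using A1[OF w] count_list_X1_X2[of w] by simp
    then show ?thesis using True by (cases w; cases "hd w") auto
  next
    case False
    then have "(1 - real (?a w)) / real (?b w) > 0" using w by (intro T_pos) (auto simp: T_def)
    then have "?a w = 0" using False by (simp add: field_simps)
    then show ?thesis ..
  qed
qed

text \<open>Pairing a word of \<open>f2\<close> with itself makes its number of \<open>X2\<close>
  odd, and pairing a word of \<open>f1\<close> with it then makes the number there even. These are
  the hypotheses of \<open>x2_graded_automorphism\<close>.\<close>

lemma AutBr_eq_G4:
  fixes q :: "var \<Rightarrow> var \<Rightarrow> 'k::field"
  assumes char: "(2 :: 'k) \<noteq> 0"
    and q: "q X1 X1 = 1" "q X1 X2 = 1" "q X2 X1 = 1" "q X2 X2 = -1"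
  shows "AutBr q = G4"
proof -
  have neq: "(1 :: 'k) \<noteq> -1" using char by (rule one_neq_minus_one)
  have chi: "braid_chi q u v = (-1) ^ (count_list u X2 * count_list v X2)" for u v
    by (simp add: braid_chi_def q)
  have sign: "(-1 :: 'k) ^ n = 1 \<longleftrightarrow> even n" "(-1 :: 'k) ^ n = -1 \<longleftrightarrow> odd n" for n
    using neq by (cases "even n"; auto)+
  show ?thesis
  proof (intro equalityI subsetI)
    fix \<phi> assume "\<phi> \<in> AutBr q"
    then obtain f1 f2 where \<phi>: "\<phi> = (f1, f2)" "(f1, f2) \<in> AutBr q" by (metis surj_pair)
    then have aut: "(f1, f2) \<in> AutFree" and comp: "compatible q f1 f2"
      using AutBr_iff[of _ _ q] by auto
    have sub: "nc_sub f1 f2 X1 = f1" "nc_sub f1 f2 X2 = f2" by (simp_all add: nc_sub_def)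
    have odd: "odd (count_list w X2)" if "f2 w \<noteq> 0" for w
    proof -
      have "braid_chi q w w = q X2 X2" using comp that sub unfolding compatible_def by metis
      then show ?thesis by (simp add: chi q sign)
    qed
    have even: "even (count_list w X2)" if w: "f1 w \<noteq> 0" for w
    proof -
      obtain v where v: "f2 v \<noteq> 0" using AutFree_nonzero[OF aut, of X2] sub by auto
      then have "braid_chi q w v = q X1 X2" using comp w sub unfolding compatible_def by metis
      then show ?thesis using odd[OF v] by (simp add: chi q sign)
    qed
    note * = x2_graded_automorphism[OF aut even odd]
    define H where "H = (\<lambda>w. if w = [X1] then 0 else f1 w)"
    have "{w. H w \<noteq> 0} \<subseteq> {w. f1 w \<noteq> 0}" by (auto simp: H_def)
    then have "H \<in> ncA" using aut by (auto simp: AutFree_def ncA_def intro: finite_subset)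
    moreover have "\<exists>k. w = replicate (2 * k) X2" if "H w \<noteq> 0" for w
    proof -
      have w: "f1 w \<noteq> 0" "w \<noteq> [X1]" using that by (auto simp: H_def split: if_splits)
      then have "count_list w X1 = 0" using *(4)[of w] by auto
      then have "X1 \<notin> set w" by (simp add: count_list_0_iff)
      then have "\<forall>a\<in>set w. a = X2" by (metis var.exhaust)
      then have "w = replicate (length w) X2" by (simp add: replicate_length_same)
      moreover have "even (length w)"
        using even[OF w(1)] \<open>count_list w X1 = 0\<close> count_list_X1_X2[of w] by simp
      ultimately show ?thesis by (metis evenE)
    qed
    ultimately have "x2_even H" by (simp add: x2_even_def)
    moreover have "f1 = (\<lambda>w. f1 [X1] * nc_var X1 w + H w)"
      by (auto simp: H_def nc_var_def)
    moreover have "f2 = scaled_var (f2 [X2]) X2" using *(3) by (rule scaled_var_eqI)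
    ultimately show "\<phi> \<in> G4" using *(1,2) \<phi>(1) unfolding G4_eq by blast
  next
    fix \<phi> :: "'k ncp \<times> 'k ncp" assume "\<phi> \<in> G4"
    then obtain \<alpha> \<beta> H where *: "\<phi> = (\<lambda>w. \<alpha> * nc_var X1 w + H w, scaled_var \<beta> X2)"
      "\<alpha> \<noteq> 0" "\<beta> \<noteq> 0" "x2_even H" unfolding G4_eq by blast
    let ?f = "\<lambda>w. \<alpha> * nc_var X1 w + H w"
    have count: "count_list (replicate n X2) X2 = n" for n by (induction n) auto
    have even: "even (count_list w X2)" if "?f w \<noteq> 0" for w
    proof (cases "w = [X1]")
      case False
      then have "H w \<noteq> 0" using that by (auto simp: nc_var_def)
      then show ?thesis using *(4) by (auto simp: x2_even_def count)
    qed simp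
    have "braid_chi q u v = q i j"
      if "nc_sub ?f (scaled_var \<beta> X2) i u \<noteq> 0" "nc_sub ?f (scaled_var \<beta> X2) j v \<noteq> 0" for i j u v
      using that even[of u] even[of v] scaled_var_support[of \<beta> X2 u] scaled_var_support[of \<beta> X2 v]
      by (cases i; cases j) (auto simp: nc_sub_def chi q)
    then show "\<phi> \<in> AutBr q"
      using * elementary_in_AutFree by (simp add: AutBr_iff compatible_def)
  qed
qed

section \<open>Exchange of the two variables\<close>

definition swap_ncp :: "('k::field) ncp \<Rightarrow> 'k ncp" where
  "swap_ncp p = (\<lambda>w. p (map swap_var w))"

lemma swap_ncp_swap_ncp [simp]: "swap_ncp (swap_ncp p) = p"
  by (simp add: swap_ncp_def)

lemma swap_ncp_in_ncA: "p \<in> ncA \<Longrightarrow> swap_ncp p \<in> ncA"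
proof -
  assume "p \<in> ncA"
  then have "finite (map swap_var ` {w. p w \<noteq> 0})" by (simp add: ncA_def)
  moreover have "{w. swap_ncp p w \<noteq> 0} \<subseteq> map swap_var ` {w. p w \<noteq> 0}"
    by (auto simp: swap_ncp_def intro!: image_eqI[where x = "map swap_var _"])
  ultimately show ?thesis unfolding ncA_def by (auto intro: finite_subset)
qed

lemma swap_ncp_mult: "swap_ncp (nc_mult f g) = nc_mult (swap_ncp f) (swap_ncp g)"
  by (simp add: swap_ncp_def nc_mult_def take_map drop_map)

lemma nc_sub_swap: "nc_sub (swap_ncp f2) (swap_ncp f1) a = swap_ncp (nc_sub f1 f2 (swap_var a))"
  by (cases a) (simp_all add: nc_sub_def)

lemma swap_ncp_eval_word:
  "swap_ncp (eval_word f1 f2 w) = eval_word (swap_ncp f2) (swap_ncp f1) (map swap_var w)"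
proof (induction w)
  case Nil
  then show ?case by (simp add: swap_ncp_def nc_one_def)
next
  case (Cons a w)
  then show ?case by (simp add: swap_ncp_mult nc_sub_swap)
qed

lemma swap_ncp_nc_hom:
  "swap_ncp (nc_hom f1 f2 p) = nc_hom (swap_ncp f2) (swap_ncp f1) (swap_ncp p)"
proof
  fix z
  have inj: "inj_on (map swap_var) S" for S
    by (rule inj_on_inverseI[where g = "map swap_var"]) simp
  have supp: "{w. swap_ncp p w \<noteq> 0} = map swap_var ` {w. p w \<noteq> 0}"
    by (auto simp: swap_ncp_def intro!: image_eqI[where x = "map swap_var _"])
  have "nc_hom (swap_ncp f2) (swap_ncp f1) (swap_ncp p) z
      = (\<Sum>w\<in>{w. p w \<noteq> 0}. p w * swap_ncp (eval_word f1 f2 w) z)"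
    unfolding nc_hom_def supp by (subst sum.reindex[OF inj]) (simp add: swap_ncp_eval_word swap_ncp_def[of p])
  then show "swap_ncp (nc_hom f1 f2 p) z = nc_hom (swap_ncp f2) (swap_ncp f1) (swap_ncp p) z"
    by (simp add: nc_hom_def swap_ncp_def)
qed

text \<open>Conjugation by the automorphism that exchanges x1 and x2; hence the components trade
  places as well.\<close>

definition swap_conj :: "('k::field) ncp \<times> 'k ncp \<Rightarrow> 'k ncp \<times> 'k ncp" where
  "swap_conj \<phi> = (swap_ncp (snd \<phi>), swap_ncp (fst \<phi>))"

lemma swap_conj_swap_conj [simp]: "swap_conj (swap_conj \<phi>) = \<phi>"
  by (simp add: swap_conj_def)

lemma swap_conj_comp: "swap_conj (aut_comp \<phi> \<psi>) = aut_comp (swap_conj \<phi>) (swap_conj \<psi>)"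
  by (simp add: swap_conj_def aut_comp_def swap_ncp_nc_hom)

lemma swap_conj_in_AutFree:
  assumes "\<phi> \<in> AutFree" shows "swap_conj \<phi> \<in> AutFree"
proof -
  obtain f1 f2 where \<phi>: "\<phi> = (f1, f2)" by fastforce
  have bij: "bij_betw swap_ncp ncA ncA"
    by (rule bij_betw_byWitness[where f' = swap_ncp]) (auto simp: swap_ncp_in_ncA)
  have "bij_betw (swap_ncp \<circ> (nc_hom f1 f2 \<circ> swap_ncp)) ncA ncA"
    using assms \<phi> by (intro bij_betw_trans[OF bij_betw_trans[OF bij] bij]) (auto simp: AutFree_def)
  moreover have "swap_ncp \<circ> (nc_hom f1 f2 \<circ> swap_ncp) = nc_hom (swap_ncp f2) (swap_ncp f1)"
    by (simp add: fun_eq_iff swap_ncp_nc_hom)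
  ultimately show ?thesis
    using assms by (auto simp: \<phi> swap_conj_def AutFree_def swap_ncp_in_ncA)
qed

lemma swap_conj_in_AutBr:
  assumes "\<phi> \<in> AutBr q"
  shows "swap_conj \<phi> \<in> AutBr (\<lambda>i j. q (swap_var i) (swap_var j))"
proof -
  let ?q = "\<lambda>i j. q (swap_var i) (swap_var j)"
  obtain f1 f2 where \<phi>: "\<phi> = (f1, f2)" by fastforce
  have count: "count_list (map swap_var w) a = count_list w (swap_var a)" for w a
  proof (induction w)
    case (Cons b w)
    then show ?case by (cases a; cases b) auto
  qed simp
  have chi: "braid_chi ?q u v = braid_chi q (map swap_var u) (map swap_var v)" for u v
    by (simp add: braid_chi_def count)
  have "compatible q f1 f2" "\<phi> \<in> AutFree" using assms \<phi> AutBr_iff[of _ _ q] by auto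
  then have "compatible ?q (swap_ncp f2) (swap_ncp f1)"
    unfolding compatible_def chi nc_sub_swap by (simp add: swap_ncp_def)
  then show ?thesis
    using swap_conj_in_AutFree[OF \<open>\<phi> \<in> AutFree\<close>] by (simp add: \<phi> swap_conj_def AutBr_iff)
qed

lemma AutBr_swap_conj_iso:
  "aut_group (AutBr q) \<cong> aut_group (AutBr (\<lambda>i j. q (swap_var i) (swap_var j)))"
    (is "?G \<cong> aut_group (AutBr ?q)")
proof -
  have "swap_conj ` AutBr q \<subseteq> AutBr ?q" using swap_conj_in_AutBr by blast
  moreover have "swap_conj ` AutBr ?q \<subseteq> AutBr q"
    using swap_conj_in_AutBr[of _ ?q] by auto
  ultimately have "bij_betw swap_conj (AutBr q) (AutBr ?q)"
    by (intro bij_betw_byWitness[where f' = swap_conj]) auto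
  then have "swap_conj \<in> iso ?G (aut_group (AutBr ?q))"
    by (auto simp: iso_def hom_def aut_group_def swap_conj_comp dest: bij_betwE)
  then show ?thesis by (auto simp: is_iso_def)
qed

text \<open>The product condition leaves open which diagonal entry is -1. If q22 = -1 the two groups
  coincide; if q22 = 1 they correspond after exchanging the variables.\<close>

lemma AutBr_G4_iso:
  assumes char: "(2 :: 'k::field) \<noteq> 0" and inv: "involutive_braiding (q :: var \<Rightarrow> var \<Rightarrow> 'k)"
    and q: "q X1 X2 = 1" "q X1 X1 * q X2 X2 = -1"
  shows "aut_group (AutBr q) \<cong> aut_group (G4 :: ('k ncp \<times> 'k ncp) set)"
proof -
  have q21: "q X2 X1 = 1" using involutive_values(3)[OF inv] q(1) by simp
  from involutive_values(2)[OF inv] show ?thesis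
  proof
    assume "q X2 X2 = -1"
    then have "AutBr q = G4" using AutBr_eq_G4[OF char, of q] q q21 by simp
    then show ?thesis using iso_set_refl by (auto simp: is_iso_def)
  next
    assume "q X2 X2 = 1"
    then have "AutBr (\<lambda>i j. q (swap_var i) (swap_var j)) = G4"
      using AutBr_eq_G4[OF char] q q21 by simp
    then show ?thesis using AutBr_swap_conj_iso[of q] by simp
  qed
qed

theorem theorem1:
  fixes q :: "var \<Rightarrow> var \<Rightarrow> 'k::field"
  assumes char: "(2::'k) \<noteq> 0"
    and inv: "involutive_braiding q"
  shows "((\<forall>i j. q i j = 1) \<longrightarrow> AutBr q = AutFree)
    \<and> ((\<forall>i j. q i j = -1) \<longrightarrow> AutBr q = Godd)
    \<and> (q X1 X1 = q X2 X2 \<and> q X1 X2 = q X2 X1 \<and> q X1 X1 * q X1 X2 = -1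
         \<longrightarrow> aut_group (AutBr q) \<cong> (units2_swap :: (('k \<times> 'k) \<times> bool) monoid))
    \<and> (q X1 X2 = 1 \<and> q X1 X1 * q X2 X2 = -1
         \<longrightarrow> aut_group (AutBr q) \<cong> aut_group (G4 :: ('k ncp \<times> 'k ncp) set))
    \<and> ((q X1 X2 \<noteq> 1 \<and> q X1 X2 \<noteq> -1) \<or> (q X1 X2 = -1 \<and> q X1 X1 * q X2 X2 = -1)
         \<longrightarrow> aut_group (AutBr q) \<cong> (units2 :: ('k \<times> 'k) monoid))"
  using AutBr_trivial_braiding[of q] AutBr_sign_braiding[OF char, of q] AutBr_swap_iso[OF char inv]
    AutBr_G4_iso[OF char inv] AutBr_diagonal_iso[OF char inv]
  by blast

end
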